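(* Let $\alpha,\beta$ be compositions such that $\beta<_c\alpha$ with $|\alpha/\!\!/\beta|=m$. Let $\preccurlyeq^t_{\alpha/\!\!/\beta}$ be any total order on $\mathrm{SRCT}(\alpha/\!\!/\beta)$ extending $\preccurlyeq_{\alpha/\!\!/\beta}$, and let $\tau_1\in\mathrm{SRCT}(\alpha/\!\!/\beta)$ be the minimal element under $\preccurlyeq^t_{\alpha/\!\!/\beta}$. Then $\mathcal{V}_{\tau_1}=\mathrm{span}_{\mathbb{C}}\{\tau_j\in\mathrm{SRCT}(\alpha/\!\!/\beta):\tau_1\preccurlyeq^t_{\alpha/\!\!/\beta}\tau_j\}$ (with $T_i$ acting as $\pi_i$) is an $H_m(0)$-module whose quasisymmetric characteristic is the skew quasisymmetric Schur function $\mathcal{S}_{\alpha/\!\!/\beta}$.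
   Context: A composition of $n$ is an ordered list of positive integers summing to $n$; $|\alpha|$ denotes the sum of the parts of $\alpha$; the empty composition has size $0$. For $S=\{i_1<\cdots<i_k\}\subseteq[n-1]$ let $\mathrm{comp}(S)=(i_1,i_2-i_1,\ldots,n-i_k)$; for a composition $\gamma=(\gamma_1,\ldots,\gamma_k)$ of $n$ let $\mathrm{set}(\gamma)=\{\gamma_1,\gamma_1+\gamma_2,\ldots,\gamma_1+\cdots+\gamma_{k-1}\}$. The reverse composition diagram of $\alpha$ is the array of left-justified cells with $\alpha_i$ cells in row $i$ from the top; $(i,j)$ is the cell in row $i$, column $j$. The reverse composition poset $(\mathcal{L}_c,<_c)$ on all compositions is defined by: $\alpha=(\alpha_1,\ldots,\alpha_\ell)$ is covered exactly by $(1,\alpha_1,\ldots,\alpha_\ell)$ and by $(\alpha_1,\ldots,\alpha_k+1,\ldots,\alpha_\ell)$ for each $k$ such that $\alpha_i\neq\alpha_k$ for all $i<k$. If $\beta<_c\alpha$, the skew reverse composition shape $\alpha/\!\!/\beta$ is the set of cells of $\alpha$ not in $\beta$, where $\beta$ is drawn in the bottom left corner of $\alpha$ (the rows of $\beta$ are aligned with the last $\ell(\beta)$ rows of $\alpha$, left-justified); its size is $|\alpha/\!\!/\beta|=|\alpha|-|\beta|$. A skew SRCT of shape $\alpha/\!\!/\beta$ of size $m$ is a bijective filling $\tau:\alpha/\!\!/\beta\to\{1,\ldots,m\}$ such that (1) entries in each row decrease from left to right; (2) entries in the first column increase from top to bottom; (3) (triple rule) setting $\tau(i,j)=\infty$ for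 all $(i,j)\in\beta$: if $i<j$, $(j,k+1)\in\alpha/\!\!/\beta$ and $\tau(i,k)>\tau(j,k+1)$, then $\tau(i,k+1)$ exists and $\tau(i,k+1)>\tau(j,k+1)$. $\mathrm{SRCT}(\alpha/\!\!/\beta)$ is the set of these. $\mathrm{Des}(\tau)=\{i\in[m-1]: i+1\text{ appears weakly right of }i\}$ and $\mathrm{comp}(\tau)=\mathrm{comp}(\mathrm{Des}(\tau))$, a composition of $m$. Entries $i,i+1$ are attacking in $\tau$ if they are in the same column, or in adjacent columns with $i+1$ strictly southeast of $i$. For $1\leq i\leq m-1$, $\pi_i(\tau)=\tau$ if $i\notin\mathrm{Des}(\tau)$; $\pi_i(\tau)=0$ if $i\in\mathrm{Des}(\tau)$ and $i,i+1$ are attacking; $\pi_i(\tau)=s_i(\tau)$, the skew SRCT obtained by interchanging the positions of $i$ and $i+1$, if $i\in\mathrm{Des}(\tau)$ and $i,i+1$ are non-attacking; extend linearly. These satisfy the relations of the $0$-Hecke algebra $H_m(0)$ ($\mathbb{C}$-algebra generated by $T_1,\ldots,T_{m-1}$ with $T_i^2=T_i$, $T_iT_{i+1}T_i=T_{i+1}T_iT_{i+1}$, $T_iT_j=T_jT_i$ for $|i-j|\geq2$), so $\pi_\sigma:=\pi_{i_1}\cdots\pi_{i_p}$ is well defined for $\sigma\in\mathfrak{S}_m$ with reduced word $s_{i_1}\cdots s_{i_p}$. The partial order $\preccurlyeq_{\alpha/\!\!/\beta}$ on $\mathrm{SRCT}(\alpha/\!\!/\beta)$ is: $\tau\preccurlyeq_{\alpha/\!\!/\beta}\tau'$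 iff $\pi_\sigma(\tau)=\tau'$ for some $\sigma\in\mathfrak{S}_m$. The fundamental quasisymmetric function, for a composition $\gamma$ of $m$, is $F_\gamma=\sum x_{i_1}\cdots x_{i_m}$ over $1\leq i_1\leq\cdots\leq i_m$ with $i_j<i_{j+1}$ if $j\in\mathrm{set}(\gamma)$. The skew quasisymmetric Schur function is $\mathcal{S}_{\alpha/\!\!/\beta}=\sum_{\tau\in\mathrm{SRCT}(\alpha/\!\!/\beta)}F_{\mathrm{comp}(\tau)}$. The irreducible $H_m(0)$-modules are the one-dimensional modules $\mathbf{F}_\gamma=\mathbb{C}v_\gamma$, $\gamma$ a composition of $m$, with $T_iv_\gamma=0$ if $i\in\mathrm{set}(\gamma)$ and $T_iv_\gamma=v_\gamma$ otherwise. The quasisymmetric characteristic $ch$ is the linear map from the Grothendieck group of finite-dimensional $H_m(0)$-modules (with $[M]=[M']+[M'']$ for short exact sequences $0\to M'\to M\to M''\to0$) to quasisymmetric functions with $ch([\mathbf{F}_\gamma])=F_\gamma$; the quasisymmetric characteristic of $M$ is $ch([M])$. *)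

theory Defs
  imports
    Complex_Main
    "HOL-Library.Poly_Mapping"
    "HOL-Library.Multiset"
    "HOL-Library.Extended_Nat"
    "HOL-Combinatorics.Permutations"
    "HOL-Algebra.Free_Abelian_Groups"
begin

section \<open>Compositions\<close>

definition is_composition :: "nat list \<Rightarrow> bool" where
  "is_composition \<gamma> \<longleftrightarrow> 0 \<notin> set \<gamma>"

definition compositions :: "nat \<Rightarrow> nat list set" where
  "compositions n = {\<gamma>. is_composition \<gamma> \<and> sum_list \<gamma> = n}"

definition set_of_comp :: "nat list \<Rightarrow> nat set" where
  "set_of_comp \<gamma> = {sum_list (take k \<gamma>) | k. 1 \<le> k \<and> k < length \<gamma>}"

text \<open>\<open>comp(S)\<close> for \<open>S \<subseteq> {1..<n}\<close>; the unique composition of \<open>0\<close> is the empty one.\<close>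

definition comp_of_set :: "nat \<Rightarrow> nat set \<Rightarrow> nat list" where
  "comp_of_set n S =
     (if n = 0 then []
      else let xs = sorted_list_of_set S in map2 (-) (xs @ [n]) (0 # xs))"

section \<open>The reverse composition poset and skew shapes\<close>

text \<open>\<open>rc_covered \<beta> \<alpha>\<close>: \<open>\<beta>\<close> is covered by \<open>\<alpha>\<close>. List positions are counted from \<open>0\<close>.\<close>

definition rc_covered :: "nat list \<Rightarrow> nat list \<Rightarrow> bool" where
  "rc_covered \<beta> \<alpha> \<longleftrightarrow>
     \<alpha> = 1 # \<beta> \<or>
     (\<exists>k<length \<beta>. (\<forall>i<k. \<beta> ! i \<noteq> \<beta> ! k) \<and> \<alpha> = \<beta>[k := \<beta> ! k + 1])"

definition rc_less :: "nat list \<Rightarrow> nat list \<Rightarrow> bool" where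
  "rc_less = rc_covered\<^sup>+\<^sup>+"

text \<open>Cells are pairs (row, column), both counted from \<open>1\<close>, rows from the top.\<close>

type_synonym cell = "nat \<times> nat"

definition diagram :: "nat list \<Rightarrow> cell set" where
  "diagram \<alpha> = {(i, j). 1 \<le> i \<and> i \<le> length \<alpha> \<and> 1 \<le> j \<and> j \<le> \<alpha> ! (i - 1)}"

definition inner_diagram :: "nat list \<Rightarrow> nat list \<Rightarrow> cell set" where
  "inner_diagram \<alpha> \<beta> = (\<lambda>(i, j). (i + (length \<alpha> - length \<beta>), j)) ` diagram \<beta>"

definition skew_shape :: "nat list \<Rightarrow> nat list \<Rightarrow> cell set" where
  "skew_shape \<alpha> \<beta> = diagram \<alpha> - inner_diagram \<alpha> \<beta>"

definition skew_size :: "nat list \<Rightarrow> nat list \<Rightarrow> nat" where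
  "skew_size \<alpha> \<beta> = sum_list \<alpha> - sum_list \<beta>"

section \<open>Skew standard reverse composition tableaux\<close>

text \<open>A filling is a function on all cells that is \<open>0\<close> off the skew shape, so that fillings
  of a given shape are equal iff they agree on that shape.\<close>

type_synonym filling = "cell \<Rightarrow> nat"

definition ext_entry :: "nat list \<Rightarrow> nat list \<Rightarrow> filling \<Rightarrow> cell \<Rightarrow> enat" where
  "ext_entry \<alpha> \<beta> \<tau> c = (if c \<in> inner_diagram \<alpha> \<beta> then \<infinity> else enat (\<tau> c))"

definition SRCT :: "nat list \<Rightarrow> nat list \<Rightarrow> filling set" where
  "SRCT \<alpha> \<beta> = {\<tau>.
     (\<forall>c. c \<notin> skew_shape \<alpha> \<beta> \<longrightarrow> \<tau> c = 0) \<and>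
     bij_betw \<tau> (skew_shape \<alpha> \<beta>) {1..skew_size \<alpha> \<beta>} \<and>
     (\<forall>i j j'. (i, j) \<in> skew_shape \<alpha> \<beta> \<and> (i, j') \<in> skew_shape \<alpha> \<beta> \<and> j < j' \<longrightarrow>
        \<tau> (i, j) > \<tau> (i, j')) \<and>
     (\<forall>i i'. (i, 1) \<in> skew_shape \<alpha> \<beta> \<and> (i', 1) \<in> skew_shape \<alpha> \<beta> \<and> i < i' \<longrightarrow>
        \<tau> (i, 1) < \<tau> (i', 1)) \<and>
     (\<forall>i j k. i < j \<and> (j, k + 1) \<in> skew_shape \<alpha> \<beta> \<and> (i, k) \<in> diagram \<alpha> \<and>
        ext_entry \<alpha> \<beta> \<tau> (i, k) > ext_entry \<alpha> \<beta> \<tau> (j, k + 1) \<longrightarrow>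
        (i, k + 1) \<in> diagram \<alpha> \<and>
        ext_entry \<alpha> \<beta> \<tau> (i, k + 1) > ext_entry \<alpha> \<beta> \<tau> (j, k + 1))}"

text \<open>Only used for entries \<open>i \<ge> 1\<close> of a tableau, which occur in exactly one cell.\<close>

definition position :: "filling \<Rightarrow> nat \<Rightarrow> cell" where
  "position \<tau> i = (THE c. \<tau> c = i)"

abbreviation row_of :: "filling \<Rightarrow> nat \<Rightarrow> nat" where
  "row_of \<tau> i \<equiv> fst (position \<tau> i)"

abbreviation col_of :: "filling \<Rightarrow> nat \<Rightarrow> nat" where
  "col_of \<tau> i \<equiv> snd (position \<tau> i)"

text \<open>Here and below \<open>m\<close> is the size of the shape.\<close>

definition Des :: "nat \<Rightarrow> filling \<Rightarrow> nat set" where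
  "Des m \<tau> = {i \<in> {1..<m}. col_of \<tau> i \<le> col_of \<tau> (i + 1)}"

definition comp_tab :: "nat \<Rightarrow> filling \<Rightarrow> nat list" where
  "comp_tab m \<tau> = comp_of_set m (Des m \<tau>)"

definition attacking :: "filling \<Rightarrow> nat \<Rightarrow> bool" where
  "attacking \<tau> i \<longleftrightarrow>
     col_of \<tau> i = col_of \<tau> (i + 1) \<or>
     (col_of \<tau> (i + 1) = col_of \<tau> i + 1 \<and> row_of \<tau> (i + 1) > row_of \<tau> i)"

section \<open>The operators on the formal complex span of tableaux\<close>

text \<open>\<^typ>\<open>'b \<Rightarrow>\<^sub>0 complex\<close> is the complex vector space with basis \<open>'b\<close>.\<close>

definition cscale :: "complex \<Rightarrow> ('b \<Rightarrow>\<^sub>0 complex) \<Rightarrow> ('b \<Rightarrow>\<^sub>0 complex)" where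
  "cscale c x = Poly_Mapping.map ((*) c) x"

lemma lookup_cscale [simp]: "Poly_Mapping.lookup (cscale c x) b = c * Poly_Mapping.lookup x b"
  by (simp add: cscale_def Poly_Mapping.map.rep_eq when_def)

interpretation cspace: vector_space "cscale :: complex \<Rightarrow> ('b \<Rightarrow>\<^sub>0 complex) \<Rightarrow> _"
  by standard (auto intro!: poly_mapping_eqI simp: lookup_add algebra_simps)

abbreviation basis_vec :: "'b \<Rightarrow> ('b \<Rightarrow>\<^sub>0 complex)" where
  "basis_vec b \<equiv> Poly_Mapping.single b 1"

definition linear_extension ::
  "('b \<Rightarrow> ('c \<Rightarrow>\<^sub>0 complex)) \<Rightarrow> ('b \<Rightarrow>\<^sub>0 complex) \<Rightarrow> ('c \<Rightarrow>\<^sub>0 complex)" where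
  "linear_extension f x = (\<Sum>b\<in>Poly_Mapping.keys x. cscale (Poly_Mapping.lookup x b) (f b))"

definition pi_tab :: "nat \<Rightarrow> nat \<Rightarrow> filling \<Rightarrow> (filling \<Rightarrow>\<^sub>0 complex)" where
  "pi_tab m i \<tau> =
     (if i \<notin> Des m \<tau> then basis_vec \<tau>
      else if attacking \<tau> i then 0
      else basis_vec (transpose i (i + 1) \<circ> \<tau>))"

definition pi_op :: "nat \<Rightarrow> nat \<Rightarrow> (filling \<Rightarrow>\<^sub>0 complex) \<Rightarrow> (filling \<Rightarrow>\<^sub>0 complex)" where
  "pi_op m i = linear_extension (pi_tab m i)"

definition perm_of_word :: "nat list \<Rightarrow> nat \<Rightarrow> nat" where
  "perm_of_word w = foldr (\<lambda>i f. transpose i (i + 1) \<circ> f) w id"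

definition reduced_word :: "nat \<Rightarrow> (nat \<Rightarrow> nat) \<Rightarrow> nat list \<Rightarrow> bool" where
  "reduced_word m \<sigma> w \<longleftrightarrow>
     set w \<subseteq> {1..<m} \<and> perm_of_word w = \<sigma> \<and>
     (\<forall>w'. set w' \<subseteq> {1..<m} \<and> perm_of_word w' = \<sigma> \<longrightarrow> length w \<le> length w')"

text \<open>On the span of \<open>SRCT(\<alpha>//\<beta>)\<close> the choice of the reduced word does not matter, because the
  operators satisfy the braid relations there.\<close>

definition pi_perm ::
  "nat \<Rightarrow> (nat \<Rightarrow> nat) \<Rightarrow> (filling \<Rightarrow>\<^sub>0 complex) \<Rightarrow> (filling \<Rightarrow>\<^sub>0 complex)" where
  "pi_perm m \<sigma> = foldr (\<lambda>i f. pi_op m i \<circ> f) (SOME w. reduced_word m \<sigma> w) id"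

definition srct_le :: "nat list \<Rightarrow> nat list \<Rightarrow> (filling \<times> filling) set" where
  "srct_le \<alpha> \<beta> = {(\<tau>, \<tau>'). \<tau> \<in> SRCT \<alpha> \<beta> \<and> \<tau>' \<in> SRCT \<alpha> \<beta> \<and>
     (\<exists>\<sigma>. \<sigma> permutes {1..skew_size \<alpha> \<beta>} \<and>
        pi_perm (skew_size \<alpha> \<beta>) \<sigma> (basis_vec \<tau>) = basis_vec \<tau>')}"

section \<open>Quasisymmetric functions\<close>

text \<open>A formal power series in \<open>x\<^sub>1, x\<^sub>2, \<dots>\<close> is given by its coefficients; the multiset
  \<open>{#i\<^sub>1, \<dots>, i\<^sub>m#}\<close> stands for the monomial \<open>x\<^bsub>i\<^sub>1\<^esub> \<cdots> x\<^bsub>i\<^sub>m\<^esub>\<close>. There is no variable \<open>x\<^sub>0\<close>.\<close>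

type_synonym pseries = "nat multiset \<Rightarrow> complex"

definition quasisymmetric :: "pseries \<Rightarrow> bool" where
  "quasisymmetric f \<longleftrightarrow>
     (\<forall>\<mu>. 0 \<in># \<mu> \<longrightarrow> f \<mu> = 0) \<and>
     (\<exists>d. \<forall>\<mu>. size \<mu> > d \<longrightarrow> f \<mu> = 0) \<and>
     (\<forall>\<gamma> is js. is_composition \<gamma> \<and> length is = length \<gamma> \<and> length js = length \<gamma> \<and>
        sorted_wrt (<) is \<and> sorted_wrt (<) js \<and> 0 \<notin> set is \<and> 0 \<notin> set js \<longrightarrow>
        f (mset (concat (map2 replicate \<gamma> is))) = f (mset (concat (map2 replicate \<gamma> js))))"

definition QSym_group :: "pseries monoid" where
  "QSym_group = \<lparr>carrier = {f. quasisymmetric f}, monoid.mult = (\<lambda>f g \<mu>. f \<mu> + g \<mu>), one = (\<lambda>_. 0)\<rparr>"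

text \<open>The coefficient of \<open>\<mu>\<close> counts the index sequences \<open>is = (i\<^sub>1, \<dots>, i\<^sub>m)\<close> in the defining sum
  whose monomial is \<open>\<mu>\<close>; \<open>i\<^sub>j\<close> is \<open>is ! (j - 1)\<close>.\<close>

definition fundamental :: "nat list \<Rightarrow> pseries" where
  "fundamental \<gamma> = (\<lambda>\<mu>. of_nat (card {is.
     length is = sum_list \<gamma> \<and> sorted is \<and> 0 \<notin> set is \<and>
     (\<forall>j\<in>set_of_comp \<gamma>. is ! (j - 1) < is ! j) \<and> mset is = \<mu>}))"

definition skew_qschur :: "nat list \<Rightarrow> nat list \<Rightarrow> pseries" where
  "skew_qschur \<alpha> \<beta> =
     (\<lambda>\<mu>. \<Sum>\<tau>\<in>SRCT \<alpha> \<beta>. fundamental (comp_tab (skew_size \<alpha> \<beta>) \<tau>) \<mu>)"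

section \<open>Modules over the 0-Hecke algebra\<close>

text \<open>By the presentation of \<open>H\<^sub>m(0)\<close>, a module is a complex vector space with endomorphisms
  \<open>T\<^sub>1, \<dots>, T\<^sub>m\<^sub>-\<^sub>1\<close> satisfying the defining relations. Underlying spaces are subspaces of
  \<^typ>\<open>'b \<Rightarrow>\<^sub>0 complex\<close>; for infinite \<open>'b\<close> every finite-dimensional module is isomorphic to
  one of this form. The values of \<open>haction\<close> outside \<open>hspace\<close> and at indices outside \<open>{1..<m}\<close>
  are irrelevant.\<close>

record 'b hmodule =
  hspace :: "('b \<Rightarrow>\<^sub>0 complex) set"
  haction :: "nat \<Rightarrow> ('b \<Rightarrow>\<^sub>0 complex) \<Rightarrow> ('b \<Rightarrow>\<^sub>0 complex)"

definition linear_between ::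
  "('b \<Rightarrow>\<^sub>0 complex) set \<Rightarrow> ('b \<Rightarrow>\<^sub>0 complex) set \<Rightarrow> (('b \<Rightarrow>\<^sub>0 complex) \<Rightarrow> ('b \<Rightarrow>\<^sub>0 complex)) \<Rightarrow> bool"
  where
  "linear_between V W f \<longleftrightarrow>
     f ` V \<subseteq> W \<and>
     (\<forall>x\<in>V. \<forall>y\<in>V. f (x + y) = f x + f y) \<and>
     (\<forall>c. \<forall>x\<in>V. f (cscale c x) = cscale c (f x))"

definition is_hmodule :: "nat \<Rightarrow> 'b hmodule \<Rightarrow> bool" where
  "is_hmodule m M \<longleftrightarrow>
     cspace.subspace (hspace M) \<and>
     (\<forall>i\<in>{1..<m}. linear_between (hspace M) (hspace M) (haction M i)) \<and>
     (\<forall>i\<in>{1..<m}. \<forall>x\<in>hspace M. haction M i (haction M i x) = haction M i x) \<and>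
     (\<forall>i. 1 \<le> i \<and> i + 1 < m \<longrightarrow> (\<forall>x\<in>hspace M.
        haction M i (haction M (i + 1) (haction M i x)) =
        haction M (i + 1) (haction M i (haction M (i + 1) x)))) \<and>
     (\<forall>i\<in>{1..<m}. \<forall>j\<in>{1..<m}. i + 2 \<le> j \<or> j + 2 \<le> i \<longrightarrow> (\<forall>x\<in>hspace M.
        haction M i (haction M j x) = haction M j (haction M i x)))"

definition fd_hmodules :: "nat \<Rightarrow> 'b hmodule set" where
  "fd_hmodules m = {M. is_hmodule m M \<and> (\<exists>B. finite B \<and> cspace.span B = hspace M)}"

definition hmodule_hom ::
  "nat \<Rightarrow> 'b hmodule \<Rightarrow> 'b hmodule \<Rightarrow> (('b \<Rightarrow>\<^sub>0 complex) \<Rightarrow> ('b \<Rightarrow>\<^sub>0 complex)) \<Rightarrow> bool" where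
  "hmodule_hom m M N f \<longleftrightarrow>
     linear_between (hspace M) (hspace N) f \<and>
     (\<forall>i\<in>{1..<m}. \<forall>x\<in>hspace M. f (haction M i x) = haction N i (f x))"

definition short_exact :: "nat \<Rightarrow> 'b hmodule \<Rightarrow> 'b hmodule \<Rightarrow> 'b hmodule \<Rightarrow> bool" where
  "short_exact m M' M M'' \<longleftrightarrow>
     (\<exists>f g. hmodule_hom m M' M f \<and> hmodule_hom m M M'' g \<and>
        inj_on f (hspace M') \<and> g ` hspace M = hspace M'' \<and>
        f ` hspace M' = {x \<in> hspace M. g x = 0})"

section \<open>The Grothendieck group and the quasisymmetric characteristic\<close>

definition groth_relations :: "nat \<Rightarrow> ('b hmodule \<Rightarrow>\<^sub>0 int) set" where
  "groth_relations m = generate (free_Abelian_group (fd_hmodules m))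
     {frag_of M - frag_of M' - frag_of M'' | M M' M''.
        M \<in> fd_hmodules m \<and> M' \<in> fd_hmodules m \<and> M'' \<in> fd_hmodules m \<and>
        short_exact m M' M M''}"

definition groth_group :: "nat \<Rightarrow> ('b hmodule \<Rightarrow>\<^sub>0 int) set monoid" where
  "groth_group m = free_Abelian_group (fd_hmodules m) Mod groth_relations m"

definition groth_class :: "nat \<Rightarrow> 'b hmodule \<Rightarrow> ('b hmodule \<Rightarrow>\<^sub>0 int) set" where
  "groth_class m M = groth_relations m #>\<^bsub>free_Abelian_group (fd_hmodules m)\<^esub> frag_of M"

text \<open>\<open>simple_hmodule \<gamma> v\<close> is the one-dimensional module \<open>F\<^sub>\<gamma> = \<complex>v\<close>, for \<open>v \<noteq> 0\<close>.\<close>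

definition simple_hmodule :: "nat list \<Rightarrow> ('b \<Rightarrow>\<^sub>0 complex) \<Rightarrow> 'b hmodule" where
  "simple_hmodule \<gamma> v =
     \<lparr>hspace = cspace.span {v}, haction = (\<lambda>i x. if i \<in> set_of_comp \<gamma> then 0 else x)\<rparr>"

text \<open>The characteristic is the additive map determined by its values on the classes of the
  irreducible modules, which generate the Grothendieck group. The choice operator only fixes the
  irrelevant values outside the carrier of the Grothendieck group.\<close>

definition is_ch :: "nat \<Rightarrow> (('b hmodule \<Rightarrow>\<^sub>0 int) set \<Rightarrow> pseries) \<Rightarrow> bool" where
  "is_ch m h \<longleftrightarrow>
     h \<in> hom (groth_group m) QSym_group \<and>
     (\<forall>\<gamma>\<in>compositions m. \<forall>v. v \<noteq> 0 \<longrightarrow>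
        h (groth_class m (simple_hmodule \<gamma> v)) = fundamental \<gamma>)"

definition ch :: "nat \<Rightarrow> ('b hmodule \<Rightarrow>\<^sub>0 int) set \<Rightarrow> pseries" where
  "ch m = (SOME h. is_ch m h)"

definition qs_characteristic :: "nat \<Rightarrow> 'b hmodule \<Rightarrow> pseries" where
  "qs_characteristic m M = ch m (groth_class m M)"

definition tableau_module ::
  "nat \<Rightarrow> nat list \<Rightarrow> nat list \<Rightarrow> (filling \<times> filling) set \<Rightarrow> filling \<Rightarrow> filling hmodule" where
  "tableau_module m \<alpha> \<beta> r \<tau>\<^sub>1 =
     \<lparr>hspace = cspace.span {basis_vec \<tau> | \<tau>. \<tau> \<in> SRCT \<alpha> \<beta> \<and> (\<tau>\<^sub>1, \<tau>) \<in> r}, haction = pi_op m\<rparr>"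

end

theory Submission
  imports Defs
begin

text \<open>The 0-Hecke relations involve only the positions of at most three or four consecutive entries
  and already hold on arbitrary fillings; applying \<open>\<pi>\<^sub>i\<close> to a tableau gives a tableau or \<open>0\<close>. A
  nontrivial swap lowers the sum of \<open>j\<close> times the column of \<open>j\<close>, so removing tableaux of maximal
  weight one by one filters the module with one-dimensional factors \<open>F\<^bsub>comp(\<tau>)\<^esub>\<close>. That the
  characteristic is well defined follows without the Jordan--Hoelder theorem: composition
  multiplicities are traces of suitable products of the \<open>T\<^sub>i\<close> and \<open>1 - T\<^sub>i\<close>, and traces are
  additive on short exact sequences.\<close>

section \<open>The 0-Hecke operators on tableaux\<close>

text \<open>\<open>ch\<close> is selected by a choice operator among the maps satisfying
  \<open>is_ch\<close>, so nothing can be said about it before one such map is exhibited; the traces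
  serve to build it. The computation for tableaux then uses only additivity on exact sequences and
  the values on the one-dimensional modules, and so applies to whichever map was selected. A trace
  detects a multiplicity although the T_i do not commute: on a one-dimensional module each T_i is
  the scalar 0 or 1, so the order of the factors of a product does not affect its value there, and
  the trace on any module depends only on the composition factors. Minimality in a total order makes
  \<open>\<tau>\<^sub>1\<close> the least element, so the module of the theorem is the span of all
  tableaux of the shape. Removing one tableau leads out of that class, which is why
  \<open>pi_closed\<close> sets of fillings carry the induction.\<close>

lemma linear_extension_superset:
  assumes "finite A" "Poly_Mapping.keys x \<subseteq> A"
  shows "linear_extension f x = (\<Sum>b\<in>A. cscale (Poly_Mapping.lookup x b) (f b))"
  unfolding linear_extension_def
  using assms by (intro sum.mono_neutral_left) (auto simp: in_keys_iff)

lemma linear_linear_extension: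
  fixes f :: "'a \<Rightarrow> ('b \<Rightarrow>\<^sub>0 complex)"
  shows "Vector_Spaces.linear cscale cscale (linear_extension f)"
proof (unfold Vector_Spaces.linear_iff, intro conjI allI)
  fix x y :: "'a \<Rightarrow>\<^sub>0 complex"
  let ?A = "Poly_Mapping.keys x \<union> Poly_Mapping.keys y"
  \<comment> \<open>Cancellation can shrink the support of a sum, so all three sums are taken over a
    common index set.\<close>
  have "Poly_Mapping.keys (x + y) \<subseteq> ?A"
    by (rule Poly_Mapping.keys_add)
  then show "linear_extension f (x + y) = linear_extension f x + linear_extension f y"
    by (simp add: linear_extension_superset[of ?A] lookup_add cspace.scale_left_distrib sum.distrib)
next
  fix c and x :: "'a \<Rightarrow>\<^sub>0 complex"
  have "Poly_Mapping.keys (cscale c x) \<subseteq> Poly_Mapping.keys x"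
    by (auto simp: in_keys_iff)
  then show "linear_extension f (cscale c x) = cscale c (linear_extension f x)"
    by (simp add: linear_extension_superset[of "Poly_Mapping.keys x"] cspace.scale_sum_right)
qed (rule cspace.vector_space_axioms)+

lemma linear_extension_basis_vec [simp]: "linear_extension f (basis_vec b) = f b"
  by (simp add: linear_extension_def)

lemma linear_pi_op: "Vector_Spaces.linear cscale cscale (pi_op m i)"
  by (simp add: pi_op_def linear_linear_extension)

lemma linear_pi_op_comp:
  "Vector_Spaces.linear cscale cscale f \<Longrightarrow> Vector_Spaces.linear cscale cscale (pi_op m i \<circ> f)"
  by (rule Vector_Spaces.linear_compose[OF _ linear_pi_op])

lemma pi_op_add: "pi_op m i (x + y) = pi_op m i x + pi_op m i y"
  and pi_op_scale: "pi_op m i (cscale c x) = cscale c (pi_op m i x)"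
  using linear_pi_op[of m i] by (auto simp: Vector_Spaces.linear_iff)

lemma pi_op_zero [simp]: "pi_op m i 0 = 0"
  by (simp add: pi_op_def linear_extension_def)

lemma pi_op_basis_vec [simp]: "pi_op m i (basis_vec \<tau>) = pi_tab m i \<tau>"
  by (simp add: pi_op_def)

lemma sum_basis_vec: "(\<Sum>b\<in>Poly_Mapping.keys x. cscale (Poly_Mapping.lookup x b) (basis_vec b)) = x"
  by (rule poly_mapping_eqI) (auto simp: Poly_Mapping.lookup_sum lookup_single when_def in_keys_iff
      if_distrib[of "(*) _"] cong: if_cong)

lemma linear_eq_basisI:
  assumes "Vector_Spaces.linear cscale cscale f" "Vector_Spaces.linear cscale cscale g"
    and "\<And>b. f (basis_vec b) = g (basis_vec b)"
  shows "f x = g x"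
proof -
  interpret F: Vector_Spaces.linear cscale cscale f by fact
  interpret G: Vector_Spaces.linear cscale cscale g by fact
  have "f (\<Sum>b\<in>Poly_Mapping.keys x. cscale (Poly_Mapping.lookup x b) (basis_vec b)) =
        g (\<Sum>b\<in>Poly_Mapping.keys x. cscale (Poly_Mapping.lookup x b) (basis_vec b))"
    by (simp add: F.sum G.sum F.scale G.scale assms(3))
  then show ?thesis by (simp only: sum_basis_vec)
qed

section \<open>The 0-Hecke relations on arbitrary fillings\<close>

lemma position_transpose: "position (transpose a b \<circ> \<tau>) j = position \<tau> (transpose a b j)"
proof -
  \<comment> \<open>The two defining predicates coincide, so the definite descriptions agree even
    for fillings in which no unique cell satisfies them.\<close>
  have "transpose a b k = j \<longleftrightarrow> k = transpose a b j" for k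
    by (metis transpose_involutory)
  then show ?thesis by (simp add: position_def)
qed

lemma Des_iff: "1 \<le> i \<Longrightarrow> i < m \<Longrightarrow> i \<in> Des m \<tau> \<longleftrightarrow> col_of \<tau> i \<le> col_of \<tau> (i + 1)"
  by (simp add: Des_def)

text \<open>After a swap at a non-attacking descent, \<open>i + 1\<close> stands strictly left of
  \<open>i\<close>, so \<open>i\<close> is no longer a descent and the second application does
  nothing.\<close>

lemma pi_op_idem: "pi_op m i (pi_op m i x) = pi_op m i x"
proof -
  have "(pi_op m i \<circ> pi_op m i) x = pi_op m i x"
  proof (rule linear_eq_basisI[where f = "pi_op m i \<circ> pi_op m i" and g = "pi_op m i"])
    show "(pi_op m i \<circ> pi_op m i) (basis_vec \<tau>) = pi_op m i (basis_vec \<tau>)" for \<tau>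
      by (auto simp: pi_tab_def Des_def attacking_def position_transpose)
  qed (intro linear_pi_op linear_pi_op_comp)+
  then show ?thesis by simp
qed

lemma transpose_comp_commute:
  assumes "a \<noteq> c" "a \<noteq> d" "b \<noteq> c" "b \<noteq> d"
  shows "transpose a b \<circ> (transpose c d \<circ> \<tau>) = transpose c d \<circ> (transpose a b \<circ> \<tau>)"
  using assms by (auto simp: fun_eq_iff transpose_def)

lemma pi_op_commute:
  assumes "i + 2 \<le> j \<or> j + 2 \<le> i"
  shows "pi_op m i (pi_op m j x) = pi_op m j (pi_op m i x)"
proof -
  have tr: "transpose i (Suc i) j = j" "transpose i (Suc i) (Suc j) = Suc j"
    "transpose j (Suc j) i = i" "transpose j (Suc j) (Suc i) = Suc i"
    using assms by (auto simp: transpose_def)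
  have "(pi_op m i \<circ> pi_op m j) x = (pi_op m j \<circ> pi_op m i) x"
  proof (rule linear_eq_basisI[where f = "pi_op m i \<circ> pi_op m j" and g = "pi_op m j \<circ> pi_op m i"])
    show "(pi_op m i \<circ> pi_op m j) (basis_vec \<tau>) = (pi_op m j \<circ> pi_op m i) (basis_vec \<tau>)" for \<tau>
      using transpose_comp_commute[of i j "Suc j" "Suc i" \<tau>] assms
      by (auto simp: pi_tab_def Des_def attacking_def position_transpose tr)
  qed (intro linear_pi_op linear_pi_op_comp)+
  then show ?thesis by simp
qed

lemma transpose_comp_braid:
  "transpose i (i + 1) \<circ> (transpose (i + 1) (i + 2) \<circ> (transpose i (i + 1) \<circ> \<tau>)) =
   transpose (i + 1) (i + 2) \<circ> (transpose i (i + 1) \<circ> (transpose (i + 1) (i + 2) \<circ> \<tau>))"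
  for i :: nat
  by (auto simp: fun_eq_iff transpose_def)

text \<open>Let p, q, r be the cells of \<open>i\<close>, \<open>i + 1\<close>,
  \<open>i + 2\<close>. Each of the pairs (p, q) and (q, r) is a non-descent, an attacking descent
  or a non-attacking descent; the pair (p, r) is left to the conditionals in the operators. If one
  of the two pairs attacks, both sides are 0. If both are non-attacking descents, both sides perform
  all three swaps and agree by the braid relation of transpositions.\<close>

lemma pi_op_braid:
  assumes "1 \<le> i" "i + 1 < m"
  shows "pi_op m i (pi_op m (i + 1) (pi_op m i x)) = pi_op m (i + 1) (pi_op m i (pi_op m (i + 1) x))"
proof -
  have "(pi_op m i \<circ> (pi_op m (i + 1) \<circ> pi_op m i)) x =
        (pi_op m (i + 1) \<circ> (pi_op m i \<circ> pi_op m (i + 1))) x"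
  proof (rule linear_eq_basisI[where f = "pi_op m i \<circ> (pi_op m (i + 1) \<circ> pi_op m i)"
        and g = "pi_op m (i + 1) \<circ> (pi_op m i \<circ> pi_op m (i + 1))"])
    fix \<tau>
    define close where "close a b \<longleftrightarrow> snd a = snd b \<or> snd b = snd a + 1 \<and> fst a < fst b"
      for a b :: cell
    define j k where "j = i + 1" and "k = i + 2"
    define s where "s \<rho> = transpose i j \<circ> \<rho>" for \<rho> :: filling
    define t where "t \<rho> = transpose j k \<circ> \<rho>" for \<rho> :: filling
    define p q r where pqr: "p = position \<tau> i" "q = position \<tau> j" "r = position \<tau> k"
    have s: "pi_tab m i \<rho> = (if snd (position \<rho> j) < snd (position \<rho> i) then basis_vec \<rho>
        else if close (position \<rho> i) (position \<rho> j) then 0 else basis_vec (s \<rho>))" for \<rho>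
      using assms by (simp add: pi_tab_def Des_iff attacking_def close_def s_def j_def)
    have t: "pi_tab m j \<rho> = (if snd (position \<rho> k) < snd (position \<rho> j) then basis_vec \<rho>
        else if close (position \<rho> j) (position \<rho> k) then 0 else basis_vec (t \<rho>))" for \<rho>
      using assms by (simp add: pi_tab_def Des_iff attacking_def close_def t_def j_def k_def)
    have pos_s: "position (s \<rho>) i = position \<rho> j" "position (s \<rho>) j = position \<rho> i"
      "position (s \<rho>) k = position \<rho> k" for \<rho>
      by (simp_all add: s_def j_def k_def position_transpose transpose_def)
    have pos_t: "position (t \<rho>) i = position \<rho> i" "position (t \<rho>) j = position \<rho> k"
      "position (t \<rho>) k = position \<rho> j" for \<rho>
      by (simp_all add: t_def j_def k_def position_transpose transpose_def)
    have sts: "s (t (s \<tau>)) = t (s (t \<tau>))"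
      unfolding s_def t_def j_def k_def by (rule transpose_comp_braid)
    \<comment> \<open>Two strict column steps put r at least two columns to the right of p, beyond
      the reach of an attack.\<close>
    have far: "\<not> close p r" if "snd p < snd q" "snd q < snd r"
      using that by (auto simp: close_def)
    have tri: "snd b < snd a \<or> snd a \<le> snd b \<and> close a b \<or> snd a < snd b \<and> \<not> close a b" for a b
      unfolding close_def by linarith
    have "pi_op m i (pi_op m j (pi_tab m i \<tau>)) = pi_op m j (pi_op m i (pi_tab m j \<tau>))"
      using tri[where a = p and b = q] tri[where a = q and b = r]
      by (elim disjE conjE; simp add: s t pos_s pos_t far sts pqr[symmetric])
    then show "(pi_op m i \<circ> (pi_op m (i + 1) \<circ> pi_op m i)) (basis_vec \<tau>) =
      (pi_op m (i + 1) \<circ> (pi_op m i \<circ> pi_op m (i + 1))) (basis_vec \<tau>)"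
      by (simp add: j_def)
  qed (intro linear_pi_op linear_pi_op_comp)+
  then show ?thesis by simp
qed

section \<open>Finiteness of the set of tableaux and its closure under swaps\<close>

lemma finite_skew_shape: "finite (skew_shape \<alpha> \<beta>)"
proof -
  have "diagram \<alpha> \<subseteq> (\<Union>i\<in>{1..length \<alpha>}. {i} \<times> {1..\<alpha> ! (i - 1)})"
    by (auto simp: diagram_def)
  then have "finite (diagram \<alpha>)"
    by (rule finite_subset) auto
  then show ?thesis by (simp add: skew_shape_def)
qed

lemma finite_SRCT: "finite (SRCT \<alpha> \<beta>)"
proof -
  let ?S = "skew_shape \<alpha> \<beta>" and ?n = "skew_size \<alpha> \<beta>"
  have "finite {\<tau>. \<forall>c. (c \<in> ?S \<longrightarrow> \<tau> c \<in> {1..?n}) \<and> (c \<notin> ?S \<longrightarrow> \<tau> c = 0)}"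
    by (rule finite_set_of_finite_funs) (auto simp: finite_skew_shape)
  moreover have "SRCT \<alpha> \<beta> \<subseteq> {\<tau>. \<forall>c. (c \<in> ?S \<longrightarrow> \<tau> c \<in> {1..?n}) \<and> (c \<notin> ?S \<longrightarrow> \<tau> c = 0)}"
    by (auto simp: SRCT_def dest!: bij_betw_imp_surj_on)
  ultimately show ?thesis by (rule rev_finite_subset)
qed

text \<open>\<open>position\<close> searches all cells, not only those of the shape. Cells outside
  hold the default 0, so a positive entry occurs only inside, where the filling is
  injective.\<close>

lemma position_eq:
  assumes "\<tau> \<in> SRCT \<alpha> \<beta>" "\<tau> c = i" "1 \<le> i"
  shows "position \<tau> i = c"
proof -
  have "inj_on \<tau> (skew_shape \<alpha> \<beta>)" and z: "\<And>c. c \<notin> skew_shape \<alpha> \<beta> \<Longrightarrow> \<tau> c = 0"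
    using assms(1) by (auto simp: SRCT_def bij_betw_def)
  then have "c' = c" if "\<tau> c' = i" for c'
    by (metis assms(2,3) inj_onD not_one_le_zero that)
  with assms(2) show ?thesis
    unfolding position_def by (rule the_equality)
qed

lemma ex_position:
  assumes "\<tau> \<in> SRCT \<alpha> \<beta>" "1 \<le> i" "i \<le> skew_size \<alpha> \<beta>"
  obtains c where "c \<in> skew_shape \<alpha> \<beta>" "\<tau> c = i" "position \<tau> i = c"
proof -
  have "\<tau> ` skew_shape \<alpha> \<beta> = {1..skew_size \<alpha> \<beta>}"
    using assms(1) by (auto simp: SRCT_def bij_betw_def)
  then obtain c where "c \<in> skew_shape \<alpha> \<beta>" "\<tau> c = i"
    using assms by (metis atLeastAtMost_iff imageE)
  then show thesis using that position_eq[OF assms(1)] assms(2) by blast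
qed

text \<open>No number lies strictly between \<open>i\<close> and \<open>i + 1\<close>, so their
  exchange can reverse no other comparison.\<close>

lemma transpose_Suc_less_iff:
  fixes x y i :: nat
  assumes "\<not> (x = i \<and> y = i + 1)" "\<not> (x = i + 1 \<and> y = i)"
  shows "transpose i (i + 1) x < transpose i (i + 1) y \<longleftrightarrow> x < y"
  using assms by (auto simp: transpose_def)

text \<open>Interchanging \<open>i\<close> and \<open>i + 1\<close> only affects the comparison of these two entries, and for a
  non-attacking descent no tableau condition compares them.\<close>

lemma SRCT_swap:
  assumes T: "\<tau> \<in> SRCT \<alpha> \<beta>" and D: "i \<in> Des (skew_size \<alpha> \<beta>) \<tau>" and A: "\<not> attacking \<tau> i"
  shows "transpose i (i + 1) \<circ> \<tau> \<in> SRCT \<alpha> \<beta>"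
proof -
  let ?S = "skew_shape \<alpha> \<beta>" and ?m = "skew_size \<alpha> \<beta>" and ?t = "transpose i (i + 1)"
  have i: "1 \<le> i" "i < ?m"
    using D by (auto simp: Des_def)
  obtain a where a: "a \<in> ?S" "\<tau> a = i" "position \<tau> i = a"
    using ex_position[OF T, of i] i by auto
  obtain b where b: "b \<in> ?S" "\<tau> b = i + 1" "position \<tau> (i + 1) = b"
    using ex_position[OF T, of "i + 1"] i by auto
  have col: "snd a < snd b" and far: "\<not> (snd b = snd a + 1 \<and> fst a < fst b)"
    using D A a b by (auto simp: Des_def attacking_def)
  have pos_i: "c = a" if "\<tau> c = i" for c
    using position_eq[OF T that i(1)] a by simp
  have pos_Suc: "c = b" if "\<tau> c = i + 1" for c
    using position_eq[OF T that] b by simp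
  have less: "?t (\<tau> c) < ?t (\<tau> d) \<longleftrightarrow> \<tau> c < \<tau> d"
    if "\<not> (c = a \<and> d = b)" "\<not> (c = b \<and> d = a)" for c d
    using that pos_i pos_Suc by (intro transpose_Suc_less_iff) blast+
  have zero: "\<And>c. c \<notin> ?S \<Longrightarrow> \<tau> c = 0" and bij: "bij_betw \<tau> ?S {1..?m}"
    and row: "\<And>r j j'. (r, j) \<in> ?S \<Longrightarrow> (r, j') \<in> ?S \<Longrightarrow> j < j' \<Longrightarrow> \<tau> (r, j') < \<tau> (r, j)"
    and fst_col: "\<And>r r'. (r, 1) \<in> ?S \<Longrightarrow> (r', 1) \<in> ?S \<Longrightarrow> r < r' \<Longrightarrow> \<tau> (r, 1) < \<tau> (r', 1)"
    and triple: "\<And>r s k. r < s \<Longrightarrow> (s, k + 1) \<in> ?S \<Longrightarrow> (r, k) \<in> diagram \<alpha> \<Longrightarrow>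
        ext_entry \<alpha> \<beta> \<tau> (s, k + 1) < ext_entry \<alpha> \<beta> \<tau> (r, k) \<Longrightarrow>
        (r, k + 1) \<in> diagram \<alpha> \<and> ext_entry \<alpha> \<beta> \<tau> (s, k + 1) < ext_entry \<alpha> \<beta> \<tau> (r, k + 1)"
    using T unfolding SRCT_def mem_Collect_eq by blast+
  \<comment> \<open>In a common row, \<open>i\<close> as the entry further left would have to exceed
    \<open>i + 1\<close>.\<close>
  have rows: "fst a \<noteq> fst b"
  proof
    assume "fst a = fst b"
    then have "\<tau> b < \<tau> a"
      using row[of "fst a" "snd a" "snd b"] a(1) b(1) col by (metis prod.collapse)
    then show False using a b by simp
  qed
  have ext: "ext_entry \<alpha> \<beta> (?t \<circ> \<tau>) c < ext_entry \<alpha> \<beta> (?t \<circ> \<tau>) d \<longleftrightarrow>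
             ext_entry \<alpha> \<beta> \<tau> c < ext_entry \<alpha> \<beta> \<tau> d"
    if "\<not> (c = a \<and> d = b)" "\<not> (c = b \<and> d = a)" for c d
    using less[OF that] by (simp add: ext_entry_def)
  show ?thesis
    unfolding SRCT_def mem_Collect_eq
  proof (intro conjI allI impI; (elim conjE)?)
    fix c assume "c \<notin> ?S"
    then show "(?t \<circ> \<tau>) c = 0" using zero i by (simp add: transpose_def)
  next
    have "?t permutes {1..?m}" using i by (intro permutes_swap_id) auto
    then show "bij_betw (?t \<circ> \<tau>) ?S {1..?m}"
      using bij bij_betw_trans permutes_imp_bij by blast
  next
    fix r j j' assume *: "(r, j) \<in> ?S" "(r, j') \<in> ?S" "j < j'"
    then show "(?t \<circ> \<tau>) (r, j') < (?t \<circ> \<tau>) (r, j)"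
      using less[of "(r, j')" "(r, j)"] row[OF *] rows unfolding comp_apply by (metis fst_conv)
  next
    fix r r' assume *: "(r, 1) \<in> ?S" "(r', 1) \<in> ?S" "r < r'"
    then show "(?t \<circ> \<tau>) (r, 1) < (?t \<circ> \<tau>) (r', 1)"
      using less[of "(r, 1)" "(r', 1)"] fst_col[OF *] col unfolding comp_apply
      by (metis snd_conv less_irrefl)
  next
    fix r s k assume *: "r < s" "(s, k + 1) \<in> ?S" "(r, k) \<in> diagram \<alpha>"
      "ext_entry \<alpha> \<beta> (?t \<circ> \<tau>) (s, k + 1) < ext_entry \<alpha> \<beta> (?t \<circ> \<tau>) (r, k)"
    \<comment> \<open>With \<open>i\<close> at (r, k) and \<open>i + 1\<close> at (s, k + 1) the two
      would attack, and the opposite placement contradicts \<open>col\<close>; so this comparison is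
      unaffected by the swap. The comparison in the conclusion is between cells of one column, again
      excluded by \<open>col\<close>.\<close>
    have "ext_entry \<alpha> \<beta> \<tau> (s, k + 1) < ext_entry \<alpha> \<beta> \<tau> (r, k)"
      using *(1,4) col far by (subst (asm) ext) auto
    from triple[OF *(1-3) this]
    show "(r, k + 1) \<in> diagram \<alpha>"
      and "ext_entry \<alpha> \<beta> (?t \<circ> \<tau>) (s, k + 1) < ext_entry \<alpha> \<beta> (?t \<circ> \<tau>) (r, k + 1)"
      using ext[of "(s, k + 1)" "(r, k + 1)"] col by (metis snd_conv less_irrefl)+
  qed
qed

text \<open>Turns questions about subspaces into inclusions of supports: invariance under an
  operator and the kernel of a coordinate can then be read off from
  \<open>Poly_Mapping.keys\<close>.\<close>

lemma span_basis_vec: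
  fixes T :: "'a set"
  shows "cspace.span (basis_vec ` T) = {x. Poly_Mapping.keys x \<subseteq> T}"
proof (rule subset_antisym; rule subsetI)
  fix x assume "x \<in> cspace.span (basis_vec ` T)"
  then have "Poly_Mapping.keys x \<subseteq> T"
  proof (induction rule: cspace.span_induct_alt)
    case (step c y z)
    then have "Poly_Mapping.keys (cscale c y) \<subseteq> T"
      by (auto simp: in_keys_iff lookup_single when_def split: if_splits)
    then show ?case using step keys_add[of "cscale c y" z] by blast
  qed simp
  then show "x \<in> {x. Poly_Mapping.keys x \<subseteq> T}" by simp
next
  fix x :: "'a \<Rightarrow>\<^sub>0 complex" assume "x \<in> {x. Poly_Mapping.keys x \<subseteq> T}"
  then have "(\<Sum>b\<in>Poly_Mapping.keys x. cscale (Poly_Mapping.lookup x b) (basis_vec b))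
      \<in> cspace.span (basis_vec ` T)"
    by (intro cspace.span_sum cspace.span_scale cspace.span_base) auto
  then show "x \<in> cspace.span (basis_vec ` T)"
    by (simp only: sum_basis_vec)
qed

text \<open>Invariance of the span of \<open>T\<close> under the operators, expressed on fillings:
  fixed fillings stay in \<open>T\<close> anyway and attacking descents give 0, so only swaps can
  lead out.\<close>

definition pi_closed :: "nat \<Rightarrow> filling set \<Rightarrow> bool" where
  "pi_closed m T \<longleftrightarrow> (\<forall>\<tau>\<in>T. \<forall>i\<in>Des m \<tau>. attacking \<tau> i \<or> transpose i (i + 1) \<circ> \<tau> \<in> T)"

definition span_module :: "nat \<Rightarrow> filling set \<Rightarrow> filling hmodule" where
  "span_module m T = \<lparr>hspace = cspace.span (basis_vec ` T), haction = pi_op m\<rparr>"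

lemma pi_closed_SRCT: "pi_closed (skew_size \<alpha> \<beta>) (SRCT \<alpha> \<beta>)"
  using SRCT_swap by (auto simp: pi_closed_def)

lemma keys_pi_op:
  assumes "pi_closed m T" "Poly_Mapping.keys x \<subseteq> T"
  shows "Poly_Mapping.keys (pi_op m i x) \<subseteq> T"
proof -
  have "pi_tab m i b \<in> cspace.span (basis_vec ` T)" if "b \<in> T" for b
    using assms(1) that by (auto simp: pi_tab_def pi_closed_def span_basis_vec)
  then have "pi_op m i x \<in> cspace.span (basis_vec ` T)"
    using assms(2) unfolding pi_op_def linear_extension_def
    by (intro cspace.span_sum cspace.span_scale) auto
  then show ?thesis by (simp add: span_basis_vec)
qed

lemma span_module_in_fd_hmodules:
  assumes "pi_closed m T" "finite T"
  shows "span_module m T \<in> fd_hmodules m"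
proof -
  have "is_hmodule m (span_module m T)"
    unfolding is_hmodule_def linear_between_def span_module_def
    using keys_pi_op[OF assms(1)]
    using cspace.subspace_span[of "basis_vec ` T"]
    by (auto simp: span_basis_vec pi_op_add pi_op_scale pi_op_idem
        pi_op_braid[simplified] pi_op_commute[simplified])
  then show ?thesis using assms(2) by (auto simp: fd_hmodules_def span_module_def)
qed

section \<open>Traces\<close>

lemma linear_betweenD:
  assumes "linear_between V W f"
  shows "x \<in> V \<Longrightarrow> f x \<in> W"
    and "x \<in> V \<Longrightarrow> y \<in> V \<Longrightarrow> f (x + y) = f x + f y"
    and "x \<in> V \<Longrightarrow> f (cscale c x) = cscale c (f x)"
  using assms by (auto simp: linear_between_def)

lemma linear_between_zero:
  assumes "linear_between V W f" "cspace.subspace V"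
  shows "f 0 = 0"
  using linear_betweenD(3)[OF assms(1), of 0 0] cspace.subspace_0[OF assms(2)] by simp

lemma linear_between_diff:
  assumes "linear_between V W f" "cspace.subspace V" "x \<in> V" "y \<in> V"
  shows "f (x - y) = f x - f y"
  using linear_betweenD(2)[OF assms(1), of "x - y" y] cspace.subspace_diff[OF assms(2,3,4)] assms(4)
  by simp

lemma linear_between_sum:
  assumes "linear_between V W f" "cspace.subspace V" "\<And>j. j \<in> J \<Longrightarrow> v j \<in> V"
  shows "f (\<Sum>j\<in>J. cscale (c j) (v j)) = (\<Sum>j\<in>J. cscale (c j) (f (v j)))"
  using assms(3)
proof (induction J rule: infinite_finite_induct)
  case (insert j J)
  then have "cscale (c j) (v j) \<in> V" "(\<Sum>j\<in>J. cscale (c j) (v j)) \<in> V"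
    using assms(2) by (auto intro!: cspace.subspace_sum cspace.subspace_scale)
  then show ?case
    using insert by (simp add: linear_betweenD[OF assms(1)])
qed (auto simp: linear_between_zero[OF assms(1,2)])

lemma linear_between_comp:
  "linear_between U V f \<Longrightarrow> linear_between V W g \<Longrightarrow> linear_between U W (g \<circ> f)"
  by (auto simp: linear_between_def image_subset_iff)

definition linear_functional :: "('b \<Rightarrow>\<^sub>0 complex) set \<Rightarrow> (('b \<Rightarrow>\<^sub>0 complex) \<Rightarrow> complex) \<Rightarrow> bool" where
  "linear_functional V \<kappa> \<longleftrightarrow>
     (\<forall>x\<in>V. \<forall>y\<in>V. \<kappa> (x + y) = \<kappa> x + \<kappa> y) \<and> (\<forall>c. \<forall>x\<in>V. \<kappa> (cscale c x) = c * \<kappa> x)"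

lemma linear_functional_sum:
  assumes "linear_functional V \<kappa>" "cspace.subspace V" "\<And>j. j \<in> J \<Longrightarrow> v j \<in> V"
  shows "\<kappa> (\<Sum>j\<in>J. cscale (c j) (v j)) = (\<Sum>j\<in>J. c j * \<kappa> (v j))"
  using assms(3)
proof (induction J rule: infinite_finite_induct)
  case (insert j J)
  then have "cscale (c j) (v j) \<in> V" "(\<Sum>j\<in>J. cscale (c j) (v j)) \<in> V"
    using assms(2) by (auto intro!: cspace.subspace_sum cspace.subspace_scale)
  then show ?case
    using insert assms(1) by (simp add: linear_functional_def)
next
  case empty
  have "\<kappa> (cscale 0 0) = 0 * \<kappa> 0"
    using assms(1) cspace.subspace_0[OF assms(2)] unfolding linear_functional_def by blast
  then show ?case by simp
next
  case (infinite J)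
  have "\<kappa> (cscale 0 0) = 0 * \<kappa> 0"
    using assms(1) cspace.subspace_0[OF assms(2)] unfolding linear_functional_def by blast
  then show ?case using infinite by simp
qed

text \<open>The vectors of a frame only have to span: the trace formula below does not need their
  independence.\<close>

definition frame ::
  "('b \<Rightarrow>\<^sub>0 complex) set \<Rightarrow> 'j set \<Rightarrow> ('j \<Rightarrow> ('b \<Rightarrow>\<^sub>0 complex)) \<Rightarrow> ('j \<Rightarrow> ('b \<Rightarrow>\<^sub>0 complex) \<Rightarrow> complex) \<Rightarrow> bool"
  where
  "frame V J v \<kappa> \<longleftrightarrow> finite J \<and> (\<forall>j\<in>J. v j \<in> V \<and> linear_functional V (\<kappa> j)) \<and>
     (\<forall>x\<in>V. (\<Sum>j\<in>J. cscale (\<kappa> j x) (v j)) = x)"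

text \<open>The argument for tr(AB) = tr(BA): expand f (v j) in the second frame, exchange the sums,
  and recognise inside f the expansion of w k in the first frame.\<close>

lemma frame_trace_unique:
  assumes F: "frame V J v \<kappa>" and G: "frame V K w \<mu>"
    and V: "cspace.subspace V" and f: "linear_between V V f"
  shows "(\<Sum>j\<in>J. \<kappa> j (f (v j))) = (\<Sum>k\<in>K. \<mu> k (f (w k)))"
proof -
  have "(\<Sum>j\<in>J. \<kappa> j (f (v j))) = (\<Sum>j\<in>J. \<kappa> j (\<Sum>k\<in>K. cscale (\<mu> k (f (v j))) (w k)))"
    using F G linear_betweenD(1)[OF f] by (intro sum.cong) (auto simp: frame_def)
  also have "\<dots> = (\<Sum>j\<in>J. \<Sum>k\<in>K. \<mu> k (f (v j)) * \<kappa> j (w k))"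
    using F G V by (intro sum.cong refl linear_functional_sum) (auto simp: frame_def)
  also have "\<dots> = (\<Sum>k\<in>K. \<Sum>j\<in>J. \<kappa> j (w k) * \<mu> k (f (v j)))"
    by (subst sum.swap) (simp add: mult.commute)
  also have "\<dots> = (\<Sum>k\<in>K. \<mu> k (\<Sum>j\<in>J. cscale (\<kappa> j (w k)) (f (v j))))"
    using F G V linear_betweenD(1)[OF f]
    by (intro sum.cong refl linear_functional_sum[symmetric]) (auto simp: frame_def)
  also have "\<dots> = (\<Sum>k\<in>K. \<mu> k (f (\<Sum>j\<in>J. cscale (\<kappa> j (w k)) (v j))))"
    using F by (intro sum.cong refl arg_cong[where f = "\<mu> _"] linear_between_sum[OF f V, symmetric])
      (auto simp: frame_def)
  also have "\<dots> = (\<Sum>k\<in>K. \<mu> k (f (w k)))"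
    using F G by (intro sum.cong) (auto simp: frame_def)
  finally show ?thesis .
qed

text \<open>The basis is an arbitrary choice. For an endomorphism of a finite-dimensional space,
  \<open>trace_on_eq\<close> allows any frame in its place.\<close>

definition trace_on :: "('b \<Rightarrow>\<^sub>0 complex) set \<Rightarrow> (('b \<Rightarrow>\<^sub>0 complex) \<Rightarrow> ('b \<Rightarrow>\<^sub>0 complex)) \<Rightarrow> complex" where
  "trace_on V f =
     (let B = (SOME B. finite B \<and> cspace.independent B \<and> cspace.span B = V)
      in \<Sum>b\<in>B. cspace.representation B (f b) b)"

lemma frame_basis:
  assumes "finite B" "cspace.independent B" "cspace.span B = V"
  shows "frame V B (\<lambda>b. b) (\<lambda>b x. cspace.representation B x b)"
  using assms cspace.span_superset[of B]
  by (auto simp: frame_def linear_functional_def cspace.representation_add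
      cspace.representation_scale intro!: cspace.sum_representation_eq)

lemma ex_basis:
  assumes "finite C" "cspace.span C = V"
  shows "\<exists>B. finite B \<and> cspace.independent B \<and> cspace.span B = V"
proof -
  obtain B where "B \<subseteq> C" "cspace.independent B" "C \<subseteq> cspace.span B"
    using cspace.maximal_independent_subset[of C] by blast
  then show ?thesis
    using assms by (metis finite_subset cspace.span_eq cspace.span_mono cspace.span_span subset_antisym)
qed

lemma trace_on_eq:
  assumes "finite C" "cspace.span C = V" and F: "frame V J v \<kappa>" and f: "linear_between V V f"
  shows "trace_on V f = (\<Sum>j\<in>J. \<kappa> j (f (v j)))"
proof -
  define B where "B = (SOME B. finite B \<and> cspace.independent B \<and> cspace.span B = V)"
  have "finite B \<and> cspace.independent B \<and> cspace.span B = V"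
    unfolding B_def using ex_basis[OF assms(1,2)] by (rule someI_ex)
  then have "frame V B (\<lambda>b. b) (\<lambda>b x. cspace.representation B x b)" "cspace.subspace V"
    using frame_basis cspace.subspace_span by blast+
  then show ?thesis
    using frame_trace_unique[OF _ F _ f] by (fastforce simp: trace_on_def B_def[symmetric] Let_def)
qed

lemma ex_frame:
  assumes "finite C" "cspace.span C = V"
  obtains B :: "('b \<Rightarrow>\<^sub>0 complex) set" and \<kappa> where "frame V B (\<lambda>b. b) \<kappa>"
  using ex_basis[OF assms] frame_basis by blast

text \<open>A frame of V is assembled from the f-images of a frame of V' and lifts of a frame of
  V''. Because the endomorphisms commute with f and g, the trace formula for this frame splits into
  the formulas for V' and V''.\<close>

lemma trace_on_exact:
  fixes V :: "('a \<Rightarrow>\<^sub>0 complex) set" and V' :: "('a \<Rightarrow>\<^sub>0 complex) set" and V'' :: "('a \<Rightarrow>\<^sub>0 complex) set"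
  assumes fin: "finite C" "cspace.span C = V" "finite C'" "cspace.span C' = V'"
      "finite C''" "cspace.span C'' = V''"
    and f: "linear_between V' V f" and g: "linear_between V V'' g"
    and inj: "inj_on f V'" and surj: "g ` V = V''" and ker: "f ` V' = {x \<in> V. g x = 0}"
    and \<phi>: "linear_between V V \<phi>" "linear_between V' V' \<phi>'" "linear_between V'' V'' \<phi>''"
    and comm: "\<And>x. x \<in> V' \<Longrightarrow> f (\<phi>' x) = \<phi> (f x)" "\<And>x. x \<in> V \<Longrightarrow> g (\<phi> x) = \<phi>'' (g x)"
  shows "trace_on V \<phi> = trace_on V' \<phi>' + trace_on V'' \<phi>''"
proof -
  have sub: "cspace.subspace V" "cspace.subspace V'" "cspace.subspace V''"
    using fin cspace.subspace_span by blast+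
  obtain J \<kappa> where F': "frame V' J (\<lambda>b. b) \<kappa>"
    using ex_frame[OF fin(3,4)] .
  obtain K \<mu> where F'': "frame V'' K (\<lambda>b. b) \<mu>"
    using ex_frame[OF fin(5,6)] .
  \<comment> \<open>Only a set-theoretic section of g. It is applied to frame vectors alone, and
    linearity of the lift of g x comes from the coordinates \<mu> k (g x).\<close>
  define s where "s = inv_into V g"
  have s: "s k \<in> V" "g (s k) = k" if "k \<in> V''" for k
    using that surj by (auto simp: s_def inv_into_into f_inv_into_f)
  \<comment> \<open>Subtracting the lift of g x leaves a vector killed by g, hence one in the image
    of f; u x is its preimage, the V'-component of x.\<close>
  define p where "p x = x - (\<Sum>k\<in>K. cscale (\<mu> k (g x)) (s k))" for x
  define u where "u = (\<lambda>x. inv_into V' f (p x))"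
  have K: "k \<in> V''" if "k \<in> K" for k
    using F'' that by (simp add: frame_def)
  have sum_in: "(\<Sum>k\<in>K. cscale (c k) (s k)) \<in> V" for c
    using sub s K by (auto intro!: cspace.subspace_sum cspace.subspace_scale)
  have p_in: "p x \<in> f ` V'" if "x \<in> V" for x
  proof -
    have "g (\<Sum>k\<in>K. cscale (\<mu> k (g x)) (s k)) = (\<Sum>k\<in>K. cscale (\<mu> k (g x)) k)"
      using s K by (subst linear_between_sum[OF g sub(1)]) auto
    also have "\<dots> = g x"
      using F'' that surj by (auto simp: frame_def)
    finally have "g (p x) = 0"
      using that sum_in by (simp add: p_def linear_between_diff[OF g sub(1)])
    moreover have "p x \<in> V"
      using that sum_in sub by (simp add: p_def cspace.subspace_diff)
    ultimately show ?thesis using ker by simp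
  qed
  have u: "u x \<in> V'" "f (u x) = p x" if "x \<in> V" for x
    using p_in[OF that] by (auto simp: u_def inv_into_into f_inv_into_f)
  have uI: "u x = y" if "p x = f y" "x \<in> V" "y \<in> V'" for x y
    using u[OF that(2)] that inj by (metis inj_onD)
  have p_lin: "p (x + y) = p x + p y" "p (cscale c x) = cscale c (p x)"
    if "x \<in> V" "y \<in> V" for x y c
    using that F'' surj
    by (auto simp: p_def linear_betweenD[OF g] frame_def linear_functional_def
        cspace.scale_left_distrib sum.distrib cspace.scale_right_diff_distrib cspace.scale_sum_right)
  have u_lin: "u (x + y) = u x + u y" "u (cscale c x) = cscale c (u x)"
    if "x \<in> V" "y \<in> V" for x y c
    using that sub u p_lin
    by (auto intro!: uI simp: linear_betweenD[OF f] cspace.subspace_add cspace.subspace_scale)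
  let ?v = "case_sum f s" and ?\<nu> = "case_sum (\<lambda>j x. \<kappa> j (u x)) (\<lambda>k x. \<mu> k (g x))"
  have J: "j \<in> V'" if "j \<in> J" for j
    using F' that by (simp add: frame_def)
  have "frame V (J <+> K) ?v ?\<nu>"
    unfolding frame_def
  proof (intro conjI ballI)
    show "finite (J <+> K)" using F' F'' by (simp add: frame_def)
  next
    fix i assume "i \<in> J <+> K"
    then show "?v i \<in> V"
      using J K s linear_betweenD(1)[OF f] by auto
    show "linear_functional V (?\<nu> i)"
      using \<open>i \<in> J <+> K\<close> F' F'' u u_lin surj
      by (auto simp: frame_def linear_functional_def linear_betweenD[OF g])
  next
    fix x assume x: "x \<in> V"
    have "(\<Sum>i\<in>J <+> K. cscale (?\<nu> i x) (?v i)) =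
        (\<Sum>j\<in>J. cscale (\<kappa> j (u x)) (f j)) + (\<Sum>k\<in>K. cscale (\<mu> k (g x)) (s k))"
      using F' F'' by (subst sum.Plus) (auto simp: frame_def)
    also have "(\<Sum>j\<in>J. cscale (\<kappa> j (u x)) (f j)) = f (\<Sum>j\<in>J. cscale (\<kappa> j (u x)) j)"
      using J by (intro linear_between_sum[OF f sub(2), symmetric])
    also have "\<dots> = p x"
      using F' u[OF x] by (simp add: frame_def)
    finally show "(\<Sum>i\<in>J <+> K. cscale (?\<nu> i x) (?v i)) = x"
      by (simp add: p_def)
  qed
  then have "trace_on V \<phi> = (\<Sum>i\<in>J <+> K. ?\<nu> i (\<phi> (?v i)))"
    using trace_on_eq[OF fin(1,2)] \<phi>(1) by blast
  also have "\<dots> = (\<Sum>j\<in>J. \<kappa> j (u (\<phi> (f j)))) + (\<Sum>k\<in>K. \<mu> k (g (\<phi> (s k))))"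
    using F' F'' by (subst sum.Plus) (auto simp: frame_def)
  also have "(\<Sum>j\<in>J. \<kappa> j (u (\<phi> (f j)))) = (\<Sum>j\<in>J. \<kappa> j (\<phi>' j))"
  proof (intro sum.cong refl arg_cong[where f = "\<kappa> _"] uI)
    fix j assume "j \<in> J"
    then have j: "\<phi>' j \<in> V'" using J linear_betweenD(1)[OF \<phi>(2)] by blast
    \<comment> \<open>On the image of f the map g vanishes, so with \<mu> k 0 = 0 the correction in
      p disappears and p is the identity there.\<close>
    then have "f (\<phi>' j) \<in> {x \<in> V. g x = 0}" using ker by blast
    moreover have "\<mu> k 0 = 0" if "k \<in> K" for k
      using F'' that linear_functional_sum[of V'' "\<mu> k" "{}"] sub by (simp add: frame_def)
    ultimately show "p (\<phi> (f j)) = f (\<phi>' j)" and "\<phi> (f j) \<in> V" "\<phi>' j \<in> V'"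
      using j comm(1)[OF J[OF \<open>j \<in> J\<close>]] by (auto simp: p_def)
  qed
  also have "\<dots> = trace_on V' \<phi>'"
    using trace_on_eq[OF fin(3,4) F' \<phi>(2)] by simp
  also have "(\<Sum>k\<in>K. \<mu> k (g (\<phi> (s k)))) = (\<Sum>k\<in>K. \<mu> k (\<phi>'' k))"
    using comm(2) s K by simp
  also have "\<dots> = trace_on V'' \<phi>''"
    using trace_on_eq[OF fin(5,6) F'' \<phi>(3)] by simp
  finally show ?thesis .
qed

section \<open>Compositions and quasisymmetric functions\<close>

lemma nth_comp_of_set:
  assumes "xs = sorted_list_of_set S" "0 < n" "k \<le> length xs"
  shows "length (comp_of_set n S) = Suc (length xs)"
    and "comp_of_set n S ! k = (xs @ [n]) ! k - (0 # xs) ! k"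
  using assms by (auto simp: comp_of_set_def Let_def nth_append)

lemma sorted_wrt_bounded_sorted_list_of_set:
  fixes n :: nat
  assumes "S \<subseteq> {1..<n}" "0 < n"
  shows "sorted_wrt (<) (0 # sorted_list_of_set S @ [n])"
proof -
  have "set (sorted_list_of_set S) = S"
    using finite_subset[OF assms(1) finite_atLeastLessThan] by simp
  then show ?thesis using assms by (auto simp: sorted_wrt_append)
qed

lemma sum_take_comp_of_set:
  assumes "S \<subseteq> {1..<n}" "0 < n" "xs = sorted_list_of_set S" "k \<le> Suc (length xs)"
  shows "sum_list (take k (comp_of_set n S)) = (0 # xs @ [n]) ! k"
  using assms(4)
proof (induction k)
  case (Suc k)
  \<comment> \<open>The strict increase makes the truncated subtraction defining the part exact, so
    that the partial sums telescope.\<close>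
  have "(0 # xs @ [n]) ! k < (0 # xs @ [n]) ! Suc k"
    using sorted_wrt_nth_less[OF sorted_wrt_bounded_sorted_list_of_set[OF assms(1,2)], of k "Suc k"] Suc.prems assms(3)
    by simp
  moreover have "(0 # xs) ! k = (0 # xs @ [n]) ! k"
    using Suc.prems by (cases k) (auto simp: nth_append)
  ultimately show ?case
    using Suc nth_comp_of_set[OF assms(3,2), of k] by (simp add: take_Suc_conv_app_nth)
qed simp

lemma comp_of_set_in_compositions:
  assumes "S \<subseteq> {1..<n}"
  shows "comp_of_set n S \<in> compositions n"
proof (cases "n = 0")
  case True
  then show ?thesis by (simp add: comp_of_set_def compositions_def is_composition_def)
next
  case False
  define xs where "xs = sorted_list_of_set S"
  have "0 < comp_of_set n S ! k" if "k < length (comp_of_set n S)" for k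
  proof -
    have k: "k \<le> length xs" using that nth_comp_of_set(1)[OF xs_def, of n 0] False by simp
    have "(0 # xs @ [n]) ! k < (0 # xs @ [n]) ! Suc k"
      using sorted_wrt_nth_less[OF sorted_wrt_bounded_sorted_list_of_set[OF assms], of k "Suc k"] False k xs_def
      by simp
    moreover have "(0 # xs) ! k = (0 # xs @ [n]) ! k"
      using k by (cases k) (auto simp: nth_append)
    ultimately show ?thesis
      using nth_comp_of_set(2)[OF xs_def _ k, of n] False by simp
  qed
  then have "0 \<notin> set (comp_of_set n S)"
    by (metis in_set_conv_nth less_irrefl)
  moreover have "sum_list (comp_of_set n S) = n"
    using sum_take_comp_of_set[OF assms _ xs_def, of "Suc (length xs)"] False
      nth_comp_of_set(1)[OF xs_def, of n 0] by (simp add: nth_append)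
  ultimately show ?thesis by (simp add: compositions_def is_composition_def)
qed

text \<open>This is what lets the generators act on the irreducible module of
  \<open>comp_tab m \<tau>\<close> according to the descent set of the tableau.\<close>

lemma set_of_comp_of_set:
  assumes "S \<subseteq> {1..<n}"
  shows "set_of_comp (comp_of_set n S) = S"
proof (cases "n = 0")
  case True
  then show ?thesis using assms by (auto simp: set_of_comp_def comp_of_set_def)
next
  case False
  define xs where "xs = sorted_list_of_set S"
  have len: "length (comp_of_set n S) = Suc (length xs)"
    using nth_comp_of_set(1)[OF xs_def, of n 0] False by simp
  have "set_of_comp (comp_of_set n S) = {(0 # xs @ [n]) ! k | k. 1 \<le> k \<and> k < Suc (length xs)}"
    unfolding set_of_comp_def len
    using sum_take_comp_of_set[OF assms _ xs_def] False
    by (intro Collect_cong ex_cong1) auto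
  \<comment> \<open>The range of k leaves out both sentinels, 0 in front and n at the end.\<close>
  also have "\<dots> = {xs ! k | k. k < length xs}"
  proof (rule subset_antisym; rule subsetI)
    fix x assume "x \<in> {(0 # xs @ [n]) ! k | k. 1 \<le> k \<and> k < Suc (length xs)}"
    then obtain k where "x = (0 # xs @ [n]) ! k" "1 \<le> k" "k < Suc (length xs)" by blast
    then show "x \<in> {xs ! k | k. k < length xs}"
      by (cases k) (auto simp: nth_append)
  next
    fix x assume "x \<in> {xs ! k | k. k < length xs}"
    then obtain k where "x = xs ! k" "k < length xs" by blast
    then have "x = (0 # xs @ [n]) ! Suc k" "1 \<le> Suc k" "Suc k < Suc (length xs)"
      by (auto simp: nth_append)
    then show "x \<in> {(0 # xs @ [n]) ! k | k. 1 \<le> k \<and> k < Suc (length xs)}" by blast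
  qed
  also have "\<dots> = S"
    using finite_subset[OF assms finite_atLeastLessThan] unfolding set_conv_nth[symmetric] xs_def by simp
  finally show ?thesis .
qed

lemma sum_list_take_strict_mono:
  assumes "is_composition \<gamma>" "k < l" "l \<le> length \<gamma>"
  shows "sum_list (take k \<gamma>) < sum_list (take l \<gamma>)"
  using assms(2,3)
proof (induction l)
  case (Suc l)
  then have "0 < \<gamma> ! l"
    using assms(1) by (metis Suc_le_lessD gr0I is_composition_def nth_mem)
  then have "sum_list (take l \<gamma>) < sum_list (take (Suc l) \<gamma>)"
    using Suc.prems by (simp add: take_Suc_conv_app_nth)
  moreover have "k < l \<Longrightarrow> sum_list (take k \<gamma>) < sum_list (take l \<gamma>)"
    using Suc by simp
  ultimately show ?case using Suc.prems by (cases "k = l") auto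
qed simp

lemma set_of_comp_subset:
  assumes "\<gamma> \<in> compositions n"
  shows "set_of_comp \<gamma> \<subseteq> {1..<n}"
proof
  fix x assume "x \<in> set_of_comp \<gamma>"
  then obtain k where k: "x = sum_list (take k \<gamma>)" "1 \<le> k" "k < length \<gamma>"
    by (auto simp: set_of_comp_def)
  then show "x \<in> {1..<n}"
    using assms sum_list_take_strict_mono[of \<gamma> 0 k] sum_list_take_strict_mono[of \<gamma> k "length \<gamma>"]
    by (auto simp: compositions_def)
qed

text \<open>The list of proper partial sums is strictly increasing, hence already the sorted list of
  its set; its consecutive differences are the parts.\<close>

lemma comp_of_set_of_comp:
  assumes "\<gamma> \<in> compositions n"
  shows "comp_of_set n (set_of_comp \<gamma>) = \<gamma>"
proof (cases "\<gamma> = []")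
  case True
  then show ?thesis using assms by (simp add: compositions_def comp_of_set_def)
next
  case False
  have \<gamma>: "is_composition \<gamma>" "sum_list \<gamma> = n"
    using assms by (auto simp: compositions_def)
  have n: "0 < n"
    using sum_list_take_strict_mono[OF \<gamma>(1), of 0 "length \<gamma>"] False \<gamma>(2) by simp
  define xs where "xs = map (\<lambda>k. sum_list (take k \<gamma>)) [1..<length \<gamma>]"
  have "sorted_wrt (<) xs"
    using sum_list_take_strict_mono[OF \<gamma>(1)] by (auto simp: xs_def sorted_wrt_iff_nth_less)
  moreover have "set xs = set_of_comp \<gamma>"
    by (auto simp: xs_def set_of_comp_def)
  ultimately have xs: "xs = sorted_list_of_set (set_of_comp \<gamma>)"
    using sorted_list_of_set.idem_if_sorted_distinct[of xs] by (simp add: strict_sorted_iff)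
  have len: "length xs = length \<gamma> - 1" by (simp add: xs_def)
  note nth = nth_comp_of_set[OF xs n]
  show ?thesis
  proof (rule nth_equalityI)
    show "length (comp_of_set n (set_of_comp \<gamma>)) = length \<gamma>"
      using nth(1)[of 0] len False by simp
    fix k assume "k < length (comp_of_set n (set_of_comp \<gamma>))"
    then have k: "k < length \<gamma>" using nth(1)[of 0] len False by simp
    have "(xs @ [n]) ! k = sum_list (take (Suc k) \<gamma>)"
    proof (cases "Suc k = length \<gamma>")
      case True
      then have "k = length xs" using len by simp
      then show ?thesis using True \<gamma> by simp
    next
      case False
      then have "k < length xs" "k < length [1..<length \<gamma>]" using k len by simp_all
      then show ?thesis by (simp add: nth_append) (simp add: xs_def)
    qed
    moreover have "(0 # xs) ! k = sum_list (take k \<gamma>)"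
      using k by (cases k) (auto simp: xs_def)
    ultimately show "comp_of_set n (set_of_comp \<gamma>) ! k = \<gamma> ! k"
      using nth(2)[of k] k len by (simp add: take_Suc_conv_app_nth)
  qed
qed

section \<open>Quasisymmetric functions and the fundamental ones among them\<close>

lemma quasisymmetricI:
  assumes "\<And>\<mu>. 0 \<in># \<mu> \<Longrightarrow> f \<mu> = 0" "\<And>\<mu>. size \<mu> > d \<Longrightarrow> f \<mu> = 0"
    and "\<And>\<gamma> is js. is_composition \<gamma> \<Longrightarrow> length is = length \<gamma> \<Longrightarrow> length js = length \<gamma> \<Longrightarrow>
      sorted_wrt (<) is \<Longrightarrow> sorted_wrt (<) js \<Longrightarrow> 0 \<notin> set is \<Longrightarrow> 0 \<notin> set js \<Longrightarrow>
      f (mset (concat (map2 replicate \<gamma> is))) = f (mset (concat (map2 replicate \<gamma> js)))"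
  shows "quasisymmetric f"
  unfolding quasisymmetric_def using assms by blast

lemma quasisymmetricE:
  assumes "quasisymmetric f"
  obtains d where "\<And>\<mu>. 0 \<in># \<mu> \<Longrightarrow> f \<mu> = 0" "\<And>\<mu>. size \<mu> > d \<Longrightarrow> f \<mu> = 0"
    "\<And>\<gamma> is js. is_composition \<gamma> \<Longrightarrow> length is = length \<gamma> \<Longrightarrow> length js = length \<gamma> \<Longrightarrow>
      sorted_wrt (<) is \<Longrightarrow> sorted_wrt (<) js \<Longrightarrow> 0 \<notin> set is \<Longrightarrow> 0 \<notin> set js \<Longrightarrow>
      f (mset (concat (map2 replicate \<gamma> is))) = f (mset (concat (map2 replicate \<gamma> js)))"
  using assms unfolding quasisymmetric_def by blast

lemma quasisymmetric_zero: "quasisymmetric (\<lambda>_. 0)"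
  by (rule quasisymmetricI) auto

lemma quasisymmetric_add:
  assumes "quasisymmetric f" "quasisymmetric g"
  shows "quasisymmetric (\<lambda>\<mu>. f \<mu> + g \<mu>)"
proof -
  from assms(1) show ?thesis
  proof (rule quasisymmetricE)
    fix d assume f: "\<And>\<mu>. 0 \<in># \<mu> \<Longrightarrow> f \<mu> = 0" "\<And>\<mu>. size \<mu> > d \<Longrightarrow> f \<mu> = 0"
      "\<And>\<gamma> is js. is_composition \<gamma> \<Longrightarrow> length is = length \<gamma> \<Longrightarrow> length js = length \<gamma> \<Longrightarrow>
        sorted_wrt (<) is \<Longrightarrow> sorted_wrt (<) js \<Longrightarrow> 0 \<notin> set is \<Longrightarrow> 0 \<notin> set js \<Longrightarrow>
        f (mset (concat (map2 replicate \<gamma> is))) = f (mset (concat (map2 replicate \<gamma> js)))"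
    from assms(2) show ?thesis
    proof (rule quasisymmetricE)
      fix e assume g: "\<And>\<mu>. 0 \<in># \<mu> \<Longrightarrow> g \<mu> = 0" "\<And>\<mu>. size \<mu> > e \<Longrightarrow> g \<mu> = 0"
        "\<And>\<gamma> is js. is_composition \<gamma> \<Longrightarrow> length is = length \<gamma> \<Longrightarrow> length js = length \<gamma> \<Longrightarrow>
          sorted_wrt (<) is \<Longrightarrow> sorted_wrt (<) js \<Longrightarrow> 0 \<notin> set is \<Longrightarrow> 0 \<notin> set js \<Longrightarrow>
          g (mset (concat (map2 replicate \<gamma> is))) = g (mset (concat (map2 replicate \<gamma> js)))"
      show ?thesis
        by (rule quasisymmetricI[where d = "max d e"])
          (simp_all add: f(1,2) g(1,2), intro arg_cong2[where f = "(+)"] f(3) g(3))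
    qed
  qed
qed

lemma quasisymmetric_mult:
  assumes "quasisymmetric f"
  shows "quasisymmetric (\<lambda>\<mu>. c * f \<mu>)"
  using assms
proof (rule quasisymmetricE)
  fix d assume f: "\<And>\<mu>. 0 \<in># \<mu> \<Longrightarrow> f \<mu> = 0" "\<And>\<mu>. size \<mu> > d \<Longrightarrow> f \<mu> = 0"
    "\<And>\<gamma> is js. is_composition \<gamma> \<Longrightarrow> length is = length \<gamma> \<Longrightarrow> length js = length \<gamma> \<Longrightarrow>
      sorted_wrt (<) is \<Longrightarrow> sorted_wrt (<) js \<Longrightarrow> 0 \<notin> set is \<Longrightarrow> 0 \<notin> set js \<Longrightarrow>
      f (mset (concat (map2 replicate \<gamma> is))) = f (mset (concat (map2 replicate \<gamma> js)))"
  show ?thesis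
    by (rule quasisymmetricI[where d = d])
      (simp_all only: f(1,2) mult_zero_right, intro arg_cong[where f = "(*) c"] f(3))
qed

lemma quasisymmetric_sum:
  "(\<And>i. i \<in> I \<Longrightarrow> quasisymmetric (f i)) \<Longrightarrow> quasisymmetric (\<lambda>\<mu>. \<Sum>i\<in>I. f i \<mu>)"
  by (induction I rule: infinite_finite_induct) (auto simp: quasisymmetric_zero quasisymmetric_add)

text \<open>Separates the block number of a position, which depends on the exponents only, from the
  variable index assigned to that block.\<close>

lemma concat_map2_replicate:
  assumes "length is = length \<gamma>"
  shows "concat (map2 replicate \<gamma> is) = map ((!) is) (concat (map2 replicate \<gamma> [0..<length \<gamma>]))"
proof -
  have "map2 replicate \<gamma> is = map (map ((!) is)) (map2 replicate \<gamma> [0..<length \<gamma>])"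
    using assms by (intro nth_equalityI) auto
  then show ?thesis by (simp add: map_concat)
qed

lemma sorted_concat_map2_replicate:
  "sorted_wrt (<) is \<Longrightarrow> length is = length \<gamma> \<Longrightarrow> sorted (concat (map2 replicate \<gamma> is))"
  for "is" :: "nat list"
proof (induction \<gamma> arbitrary: "is")
  case (Cons k \<gamma>)
  then obtain x xs where "is = x # xs" by (metis length_Suc_conv)
  with Cons show ?case
    by (auto simp: sorted_append dest!: set_zip_rightD intro: less_imp_le)
qed simp

text \<open>A monomial has only one sorted index sequence, so every coefficient is 0 or 1. Strictly
  increasing indices preserve and reflect the order of block numbers, so the required ascents depend
  on the exponents \<open>\<delta>\<close> alone and not on the variables used.\<close>

lemma quasisymmetric_fundamental:
  assumes "\<gamma> \<in> compositions n"
  shows "quasisymmetric (fundamental \<gamma>)"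
  unfolding quasisymmetric_def
proof (intro conjI allI impI)
  fix \<mu> :: "nat multiset" assume "0 \<in># \<mu>"
  then have "{is. length is = sum_list \<gamma> \<and> sorted is \<and> 0 \<notin> set is \<and>
     (\<forall>j\<in>set_of_comp \<gamma>. is ! (j - 1) < is ! j) \<and> mset is = \<mu>} = {}"
    by auto
  then show "fundamental \<gamma> \<mu> = 0"
    unfolding fundamental_def by (metis card.empty of_nat_0)
next
  have "fundamental \<gamma> \<mu> = 0" if "sum_list \<gamma> < size \<mu>" for \<mu>
  proof -
    have "{is. length is = sum_list \<gamma> \<and> sorted is \<and> 0 \<notin> set is \<and>
     (\<forall>j\<in>set_of_comp \<gamma>. is ! (j - 1) < is ! j) \<and> mset is = \<mu>} = {}"
      using that by auto
    then show ?thesis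
      unfolding fundamental_def by (metis card.empty of_nat_0)
  qed
  then show "\<exists>d. \<forall>\<mu>. d < size \<mu> \<longrightarrow> fundamental \<gamma> \<mu> = 0" by blast
next
  fix \<delta> "is" js :: "nat list"
  assume A: "is_composition \<delta> \<and> length is = length \<delta> \<and> length js = length \<delta> \<and>
    sorted_wrt (<) is \<and> sorted_wrt (<) js \<and> 0 \<notin> set is \<and> 0 \<notin> set js"
  \<comment> \<open>\<open>K\<close> lists, position by position, the number of the block to which
    the position belongs.\<close>
  define K where "K = concat (map2 replicate \<delta> [0..<length \<delta>])"
  have K: "k < length \<delta>" if "k \<in> set K" for k
    using that by (auto simp: K_def dest!: set_zip_rightD)
  define P where "P xs \<longleftrightarrow> length xs = sum_list \<gamma> \<and> (\<forall>j\<in>set_of_comp \<gamma>. xs ! (j - 1) < xs ! j)"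
    for xs :: "nat list"
  have less: "j < sum_list \<gamma>" "j - 1 < sum_list \<gamma>" if "j \<in> set_of_comp \<gamma>" for j
    using subsetD[OF set_of_comp_subset[OF assms] that] assms by (auto simp: compositions_def)
  have iff: "xs ! (K ! (j - 1)) < xs ! (K ! j) \<longleftrightarrow> K ! (j - 1) < K ! j"
    if "j \<in> set_of_comp \<gamma>" "length K = sum_list \<gamma>" "sorted_wrt (<) xs" "length xs = length \<delta>" for xs :: "nat list" and j
  proof -
    have "j < length K" "j - 1 < length K"
      using less that by simp_all
    then have "K ! (j - 1) < length xs" "K ! j < length xs"
      using K that(4) by auto
    then show ?thesis
      using sorted_wrt_nth_less[OF that(3), of "K ! (j - 1)" "K ! j"]
        sorted_wrt_nth_less[OF that(3), of "K ! j" "K ! (j - 1)"]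
      by (cases "K ! (j - 1)" "K ! j" rule: linorder_cases) auto
  qed
  have F: "fundamental \<gamma> (mset (concat (map2 replicate \<delta> xs))) =
      of_bool (length K = sum_list \<gamma> \<and> (\<forall>j\<in>set_of_comp \<gamma>. K ! (j - 1) < K ! j))"
    if xs: "length xs = length \<delta>" "sorted_wrt (<) xs" "0 \<notin> set xs" for xs :: "nat list"
  proof -
    let ?c = "concat (map2 replicate \<delta> xs)"
    have c: "?c = map ((!) xs) K"
      using concat_map2_replicate[OF xs(1)] by (simp add: K_def)
    have sorted: "sorted ?c" using sorted_concat_map2_replicate xs by blast
    have zero: "0 \<notin> set ?c" using xs(3) by (auto dest: set_zip_rightD)
    have uniq: "ys = ?c" if "sorted ys" "mset ys = mset ?c" for ys
      using properties_for_sort[OF that(2,1)] properties_for_sort[OF refl sorted] by simp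
    have "{is. length is = sum_list \<gamma> \<and> sorted is \<and> 0 \<notin> set is \<and>
       (\<forall>j\<in>set_of_comp \<gamma>. is ! (j - 1) < is ! j) \<and> mset is = mset ?c} = {is. is = ?c \<and> P ?c}"
    proof (rule Collect_cong, rule iffI)
      fix ys assume ys: "length ys = sum_list \<gamma> \<and> sorted ys \<and> 0 \<notin> set ys \<and>
       (\<forall>j\<in>set_of_comp \<gamma>. ys ! (j - 1) < ys ! j) \<and> mset ys = mset ?c"
      then have "ys = ?c" using uniq by blast
      with ys show "ys = ?c \<and> P ?c" unfolding P_def by blast
    next
      fix ys assume "ys = ?c \<and> P ?c"
      with sorted zero show "length ys = sum_list \<gamma> \<and> sorted ys \<and> 0 \<notin> set ys \<and>
       (\<forall>j\<in>set_of_comp \<gamma>. ys ! (j - 1) < ys ! j) \<and> mset ys = mset ?c"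
        unfolding P_def by blast
    qed
    moreover have "card {is. is = ?c \<and> P ?c} = of_bool (P ?c)"
      by auto
    moreover have "P ?c \<longleftrightarrow> length K = sum_list \<gamma> \<and> (\<forall>j\<in>set_of_comp \<gamma>. K ! (j - 1) < K ! j)"
    proof -
      have "map ((!) xs) K ! j = xs ! (K ! j)" "map ((!) xs) K ! (j - 1) = xs ! (K ! (j - 1))"
        if "j \<in> set_of_comp \<gamma>" "length K = sum_list \<gamma>" for j
        using less that by simp_all
      then show ?thesis using iff[OF _ _ xs(2,1)] by (auto simp: P_def c)
    qed
    ultimately show ?thesis
      unfolding fundamental_def by simp
  qed
  show "fundamental \<gamma> (mset (concat (map2 replicate \<delta> is))) =
        fundamental \<gamma> (mset (concat (map2 replicate \<delta> js)))"
    using A by (simp add: F)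
qed

section \<open>Existence of the quasisymmetric characteristic\<close>

definition isotypic_factor :: "nat set \<Rightarrow> 'b hmodule \<Rightarrow> nat \<Rightarrow> ('b \<Rightarrow>\<^sub>0 complex) \<Rightarrow> ('b \<Rightarrow>\<^sub>0 complex)" where
  "isotypic_factor S M i x = (if i \<in> S then x - haction M i x else haction M i x)"

definition isotypic_op :: "nat set \<Rightarrow> 'b hmodule \<Rightarrow> nat list \<Rightarrow> ('b \<Rightarrow>\<^sub>0 complex) \<Rightarrow> ('b \<Rightarrow>\<^sub>0 complex)" where
  "isotypic_op S M w = foldr (\<lambda>i f. isotypic_factor S M i \<circ> f) w id"

lemma isotypic_op_Nil [simp]: "isotypic_op S M [] x = x"
  by (simp add: isotypic_op_def)

lemma isotypic_op_Cons [simp]: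
  "isotypic_op S M (i # w) x = isotypic_factor S M i (isotypic_op S M w x)"
  by (simp add: isotypic_op_def)

text \<open>On the irreducible module of the subset \<open>R\<close>, the product over all \<open>i\<close> of \<open>1 - T\<^sub>i\<close> (for
  \<open>i \<in> S\<close>) or \<open>T\<^sub>i\<close> (for \<open>i \<notin> S\<close>) acts as \<open>1\<close> if \<open>R = S\<close> and as \<open>0\<close> otherwise; since traces are
  additive on short exact sequences, its trace is the multiplicity of the irreducible module of
  \<open>S\<close> as a composition factor.\<close>

definition isotypic_multiplicity :: "nat \<Rightarrow> nat set \<Rightarrow> 'b hmodule \<Rightarrow> complex" where
  "isotypic_multiplicity m S M = trace_on (hspace M) (isotypic_op S M [1..<m])"

lemma linear_between_haction:
  "is_hmodule m M \<Longrightarrow> i \<in> {1..<m} \<Longrightarrow> linear_between (hspace M) (hspace M) (haction M i)"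
  by (simp add: is_hmodule_def)

lemma subspace_hspace: "is_hmodule m M \<Longrightarrow> cspace.subspace (hspace M)"
  by (simp add: is_hmodule_def)

lemma linear_between_isotypic_factor:
  assumes "is_hmodule m M" "i \<in> {1..<m}"
  shows "linear_between (hspace M) (hspace M) (isotypic_factor S M i)"
  using linear_betweenD[OF linear_between_haction[OF assms]] subspace_hspace[OF assms(1)]
  by (auto simp: linear_between_def isotypic_factor_def cspace.subspace_diff
      cspace.scale_right_diff_distrib)

lemma linear_between_isotypic_op:
  assumes "is_hmodule m M" "set w \<subseteq> {1..<m}"
  shows "linear_between (hspace M) (hspace M) (isotypic_op S M w)"
  using assms(2)
proof (induction w)
  case (Cons i w)
  then have "linear_between (hspace M) (hspace M) (isotypic_factor S M i \<circ> isotypic_op S M w)"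
    using linear_between_comp[OF _ linear_between_isotypic_factor[OF assms(1), of i S]] by simp
  moreover have "isotypic_factor S M i \<circ> isotypic_op S M w = isotypic_op S M (i # w)"
    by (simp add: fun_eq_iff)
  ultimately show ?case by (simp only:)
qed (simp add: linear_between_def)

text \<open>Supplies the commutation with the maps of an exact sequence that additivity of the trace
  asks for.\<close>

lemma isotypic_op_hom:
  assumes M: "is_hmodule m M" and f: "hmodule_hom m M N f" and w: "set w \<subseteq> {1..<m}" and x: "x \<in> hspace M"
  shows "f (isotypic_op S M w x) = isotypic_op S N w (f x)"
  using w
proof (induction w)
  case (Cons i w)
  let ?y = "isotypic_op S M w x"
  have y: "?y \<in> hspace M"
    using linear_betweenD(1)[OF linear_between_isotypic_op[OF M]] Cons.prems x by simp
  have i: "i \<in> {1..<m}" using Cons.prems by simp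
  have lin: "linear_between (hspace M) (hspace N) f"
    and comm: "f (haction M i ?y) = haction N i (f ?y)"
    using f i y by (auto simp: hmodule_hom_def)
  have "f (isotypic_factor S M i ?y) = isotypic_factor S N i (f ?y)"
    using linear_between_diff[OF lin subspace_hspace[OF M] y
        linear_betweenD(1)[OF linear_between_haction[OF M i] y]] comm
    by (simp add: isotypic_factor_def)
  then show ?case using Cons by simp
qed simp

lemma isotypic_multiplicity_exact:
  assumes fd: "M \<in> fd_hmodules m" "M' \<in> fd_hmodules m" "M'' \<in> fd_hmodules m"
    and ex: "short_exact m M' M M''"
  shows "isotypic_multiplicity m S M = isotypic_multiplicity m S M' + isotypic_multiplicity m S M''"
proof -
  have h: "is_hmodule m M" "is_hmodule m M'" "is_hmodule m M''"
    using fd by (auto simp: fd_hmodules_def)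
  obtain B B' B'' where B: "finite B" "cspace.span B = hspace M"
    "finite B'" "cspace.span B' = hspace M'" "finite B''" "cspace.span B'' = hspace M''"
    using fd by (auto simp: fd_hmodules_def)
  obtain f g where f: "hmodule_hom m M' M f" and g: "hmodule_hom m M M'' g"
    and *: "inj_on f (hspace M')" "g ` hspace M = hspace M''"
      "f ` hspace M' = {x \<in> hspace M. g x = 0}"
    using ex by (auto simp: short_exact_def)
  have w: "set [1..<m] \<subseteq> {1..<m}" by simp
  show ?thesis
    unfolding isotypic_multiplicity_def
    using f g
    by (intro trace_on_exact[OF B _ _ * linear_between_isotypic_op[OF h(1) w]
          linear_between_isotypic_op[OF h(2) w] linear_between_isotypic_op[OF h(3) w]]
        isotypic_op_hom[OF h(2) f w] isotypic_op_hom[OF h(1) g w])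
      (auto simp: hmodule_hom_def)
qed

lemma simple_hmodule_in_fd_hmodules: "simple_hmodule \<gamma> v \<in> fd_hmodules m"
proof -
  have "is_hmodule m (simple_hmodule \<gamma> v)"
    unfolding is_hmodule_def linear_between_def simple_hmodule_def
    by (auto simp: cspace.subspace_span cspace.span_zero)
  then show ?thesis
    unfolding fd_hmodules_def by (auto simp: simple_hmodule_def intro!: exI[of _ "{v}"])
qed

text \<open>Each factor is the scalar 0 or 1 here, so a single disagreement between the two sets
  kills the whole word.\<close>

lemma isotypic_op_simple_hmodule:
  "isotypic_op S (simple_hmodule \<gamma> v) w x =
     (if \<forall>i\<in>set w. i \<in> S \<longleftrightarrow> i \<in> set_of_comp \<gamma> then x else 0)"
  by (induction w) (simp_all add: isotypic_factor_def simple_hmodule_def)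

lemma isotypic_multiplicity_simple_hmodule:
  fixes v :: "'b \<Rightarrow>\<^sub>0 complex"
  assumes \<gamma>: "\<gamma> \<in> compositions m" and v: "v \<noteq> 0" and S: "S \<subseteq> {1..<m}"
  shows "isotypic_multiplicity m S (simple_hmodule \<gamma> v) = of_bool (S = set_of_comp \<gamma>)"
proof -
  let ?M = "simple_hmodule \<gamma> v" and ?w = "[1..<m]"
  have V: "hspace ?M = cspace.span {v}" by (simp add: simple_hmodule_def)
  have ind: "cspace.independent {v}" using v by (simp add: cspace.dependent_single)
  have "is_hmodule m ?M"
    using simple_hmodule_in_fd_hmodules by (auto simp: fd_hmodules_def)
  then have lin: "linear_between (hspace ?M) (hspace ?M) (isotypic_op S ?M ?w)"
    by (rule linear_between_isotypic_op) simp
  have "isotypic_multiplicity m S ?M = cspace.representation {v} (isotypic_op S ?M ?w v) v"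
    using trace_on_eq[where C = "{v}", OF _ _ frame_basis[OF _ ind] lin]
    unfolding isotypic_multiplicity_def V by simp
  moreover have "(\<forall>i\<in>set ?w. i \<in> S \<longleftrightarrow> i \<in> set_of_comp \<gamma>) \<longleftrightarrow> S = set_of_comp \<gamma>"
    using S set_of_comp_subset[OF \<gamma>] by auto
  ultimately show ?thesis
    using cspace.representation_basis[OF ind, of v]
    by (simp add: isotypic_op_simple_hmodule cspace.representation_zero)
qed

text \<open>The expected value of \<open>ch\<close>. Summing over subsets amounts to summing over
  compositions of \<open>m\<close>, with a visibly finite index set.\<close>

definition characteristic :: "nat \<Rightarrow> 'b hmodule \<Rightarrow> pseries" where
  "characteristic m M = (\<lambda>\<mu>.
     \<Sum>S\<in>Pow {1..<m}. isotypic_multiplicity m S M * fundamental (comp_of_set m S) \<mu>)"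

lemma quasisymmetric_characteristic: "quasisymmetric (characteristic m M)"
  unfolding characteristic_def
  by (intro quasisymmetric_sum quasisymmetric_mult quasisymmetric_fundamental[where n = m]
      comp_of_set_in_compositions) auto

lemma characteristic_exact:
  assumes "M \<in> fd_hmodules m" "M' \<in> fd_hmodules m" "M'' \<in> fd_hmodules m" "short_exact m M' M M''"
  shows "characteristic m M \<mu> = characteristic m M' \<mu> + characteristic m M'' \<mu>"
  by (simp add: characteristic_def isotypic_multiplicity_exact[OF assms] distrib_right sum.distrib)

lemma characteristic_simple_hmodule:
  assumes "\<gamma> \<in> compositions m" "v \<noteq> 0"
  shows "characteristic m (simple_hmodule \<gamma> v) = fundamental \<gamma>"
proof
  fix \<mu>
  have "characteristic m (simple_hmodule \<gamma> v) \<mu> =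
      (\<Sum>S\<in>Pow {1..<m}. if S = set_of_comp \<gamma> then fundamental (comp_of_set m S) \<mu> else 0)"
    unfolding characteristic_def
    by (intro sum.cong) (auto simp: isotypic_multiplicity_simple_hmodule[OF assms])
  also have "\<dots> = fundamental \<gamma> \<mu>"
    using set_of_comp_subset[OF assms(1)] by (simp add: comp_of_set_of_comp[OF assms(1)])
  finally show "characteristic m (simple_hmodule \<gamma> v) \<mu> = fundamental \<gamma> \<mu>" .
qed

section \<open>Passage to the Grothendieck group\<close>

lemma comm_group_QSym_group: "comm_group QSym_group"
proof (rule comm_groupI)
  fix f assume "f \<in> carrier QSym_group"
  then have "quasisymmetric (\<lambda>\<mu>. (-1) * f \<mu>)"
    by (intro quasisymmetric_mult) (simp add: QSym_group_def)
  then show "\<exists>g\<in>carrier QSym_group. g \<otimes>\<^bsub>QSym_group\<^esub> f = \<one>\<^bsub>QSym_group\<^esub>"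
    by (intro bexI[of _ "\<lambda>\<mu>. (-1) * f \<mu>"]) (auto simp: QSym_group_def)
qed (auto simp: QSym_group_def quasisymmetric_zero quasisymmetric_add add_ac)

lemma groth_generators_subset:
  "{frag_of M - frag_of M' - frag_of M'' | M M' M''.
     M \<in> fd_hmodules m \<and> M' \<in> fd_hmodules m \<and> M'' \<in> fd_hmodules m \<and> short_exact m M' M M''}
   \<subseteq> carrier (free_Abelian_group (fd_hmodules m))"
  by (auto simp del: carrier_free_Abelian_group_iff
      simp: free_Abelian_group_def dest!: subsetD[OF keys_diff])

lemma normal_groth_relations:
  "groth_relations m \<lhd> free_Abelian_group (fd_hmodules m)"
proof -
  interpret F: comm_group "free_Abelian_group (fd_hmodules m)"
    by (rule abelian_free_Abelian_group)
  show ?thesis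
    unfolding groth_relations_def F.normal_iff_subgroup
    using groth_generators_subset by (rule F.generate_is_subgroup)
qed

text \<open>Extend \<open>characteristic\<close> to the free abelian group by its universal
  property; additivity on exact sequences puts the relations into the kernel, so the extension
  factors through the quotient.\<close>

lemma ex_is_ch: "\<exists>h. is_ch m (h :: ('b hmodule \<Rightarrow>\<^sub>0 int) set \<Rightarrow> pseries)"
proof -
  let ?F = "free_Abelian_group (fd_hmodules m :: 'b hmodule set)"
  interpret Q: comm_group QSym_group by (rule comm_group_QSym_group)
  obtain \<phi> where \<phi>: "\<phi> \<in> hom ?F QSym_group"
    and \<phi>_frag: "\<And>M. M \<in> fd_hmodules m \<Longrightarrow> \<phi> (frag_of M) = characteristic m M"
    by (rule Q.free_Abelian_group_universal[of "characteristic m" "fd_hmodules m :: 'b hmodule set"])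
      (auto simp: QSym_group_def quasisymmetric_characteristic)
  interpret group_hom ?F QSym_group \<phi>
    by (simp add: \<phi> group_hom_axioms_def group_hom_def)
  have "groth_relations m \<subseteq> Coset.kernel ?F QSym_group \<phi>"
    unfolding groth_relations_def
  proof (intro G.generate_subgroup_incl subgroup_kernel subsetI)
    fix x :: "'b hmodule \<Rightarrow>\<^sub>0 int"
    assume x: "x \<in> {frag_of M - frag_of M' - frag_of M'' | M M' M''.
      M \<in> fd_hmodules m \<and> M' \<in> fd_hmodules m \<and> M'' \<in> fd_hmodules m \<and> short_exact m M' M M''}"
    then obtain M M' M'' where M: "M \<in> fd_hmodules m" "M' \<in> fd_hmodules m" "M'' \<in> fd_hmodules m"
      "short_exact m M' M M''" and eq: "x = frag_of M - frag_of M' - frag_of M''"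
      by blast
    have xc: "x \<in> carrier ?F" using x groth_generators_subset by blast
    \<comment> \<open>Solved for \<open>frag_of M\<close>, the relation is a product, to which
      multiplicativity of the homomorphism applies directly.\<close>
    have "frag_of M = (x \<otimes>\<^bsub>?F\<^esub> frag_of M') \<otimes>\<^bsub>?F\<^esub> frag_of M''" by (simp add: eq)
    then have "\<phi> (frag_of M) = (\<phi> x \<otimes>\<^bsub>QSym_group\<^esub> \<phi> (frag_of M')) \<otimes>\<^bsub>QSym_group\<^esub> \<phi> (frag_of M'')"
      using xc M by (metis hom_mult G.m_closed frag_of_in_free_Abelian_group)
    then have "characteristic m M \<mu> = \<phi> x \<mu> + characteristic m M' \<mu> + characteristic m M'' \<mu>" for \<mu>
      using M by (simp add: \<phi>_frag QSym_group_def)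
    then have "\<phi> x = (\<lambda>\<mu>. 0)"
      using characteristic_exact[OF M] by (simp add: fun_eq_iff)
    then show "x \<in> Coset.kernel ?F QSym_group \<phi>"
      using xc by (simp add: kernel_def QSym_group_def)
  qed
  note FactGroup_universal_kernel[OF normal_groth_relations this]
  then obtain h where h: "h \<in> hom (?F Mod groth_relations m) QSym_group"
    "\<And>x. x \<in> carrier ?F \<Longrightarrow> h (groth_relations m #>\<^bsub>?F\<^esub> x) = \<phi> x"
    by blast
  have "is_ch m h"
    unfolding is_ch_def groth_group_def groth_class_def
    using h by (simp add: simple_hmodule_in_fd_hmodules \<phi>_frag characteristic_simple_hmodule)
  then show ?thesis by blast
qed

text \<open>The relation of the exact sequence places \<open>frag_of M\<close> and the sum of the
  two outer generators in one coset, and h is a homomorphism.\<close>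

lemma is_ch_exact:
  fixes h :: "('b hmodule \<Rightarrow>\<^sub>0 int) set \<Rightarrow> pseries"
  assumes h: "is_ch m h"
    and M: "M \<in> fd_hmodules m" "M' \<in> fd_hmodules m" "M'' \<in> fd_hmodules m" "short_exact m M' M M''"
  shows "h (groth_class m M) \<mu> = h (groth_class m M') \<mu> + h (groth_class m M'') \<mu>"
proof -
  let ?F = "free_Abelian_group (fd_hmodules m :: 'b hmodule set)"
  let ?N = "groth_relations m :: ('b hmodule \<Rightarrow>\<^sub>0 int) set"
  interpret N: normal ?N ?F by (rule normal_groth_relations)
  have c: "frag_of M \<in> carrier ?F" "frag_of M' \<in> carrier ?F" "frag_of M'' \<in> carrier ?F"
    using M by simp_all
  have "frag_of M - frag_of M' - frag_of M'' \<in> ?N"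
    unfolding groth_relations_def using M by (intro generate.incl) blast
  then have "frag_of M \<in> ?N #>\<^bsub>?F\<^esub> (frag_of M' \<otimes>\<^bsub>?F\<^esub> frag_of M'')"
    by (auto simp: r_coset_def intro!: bexI[of _ "frag_of M - frag_of M' - frag_of M''"])
  then have "?N #>\<^bsub>?F\<^esub> frag_of M = ?N #>\<^bsub>?F\<^esub> (frag_of M' \<otimes>\<^bsub>?F\<^esub> frag_of M'')"
    using c N.repr_independence[OF _ _ N.is_subgroup] N.m_closed by metis
  then have "groth_class m M = groth_class m M' <#>\<^bsub>?F\<^esub> groth_class m M''"
    using N.rcos_sum[OF c(2,3)] by (simp add: groth_class_def)
  moreover have "groth_class m M' \<in> carrier (groth_group m)" "groth_class m M'' \<in> carrier (groth_group m)"
    using c by (auto simp: groth_class_def groth_group_def carrier_FactGroup)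
  ultimately have "h (groth_class m M) = h (groth_class m M') \<otimes>\<^bsub>QSym_group\<^esub> h (groth_class m M'')"
    using h hom_mult[of h "groth_group m" QSym_group] by (simp add: is_ch_def groth_group_def)
  then show ?thesis by (simp add: QSym_group_def)
qed

section \<open>The characteristic of the tableau module\<close>

definition column_weight :: "nat \<Rightarrow> filling \<Rightarrow> nat" where
  "column_weight m \<tau> = (\<Sum>j\<in>{1..m}. j * col_of \<tau> j)"

text \<open>The weight changes by the column of \<open>i\<close> minus the column of
  \<open>i + 1\<close>. For a descent this is at most 0, and equality would mean a common column,
  hence an attack.\<close>

lemma column_weight_swap:
  assumes "i \<in> Des m \<tau>" "\<not> attacking \<tau> i"
  shows "column_weight m (transpose i (i + 1) \<circ> \<tau>) < column_weight m \<tau>"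
proof -
  let ?R = "{1..m} - {i} - {i + 1}"
  have i: "i \<in> {1..m}" "i + 1 \<in> {1..m} - {i}" and less: "col_of \<tau> i < col_of \<tau> (i + 1)"
    using assms by (auto simp: Des_def attacking_def)
  have split: "(\<Sum>j\<in>{1..m}. f j) = f i + (f (i + 1) + (\<Sum>j\<in>?R. f j))" for f :: "nat \<Rightarrow> nat"
    using i sum.remove[of "{1..m}" i f] sum.remove[of "{1..m} - {i}" "i + 1" f] by simp
  have "(\<Sum>j\<in>?R. j * col_of (transpose i (i + 1) \<circ> \<tau>) j) = (\<Sum>j\<in>?R. j * col_of \<tau> j)"
    by (intro sum.cong refl) (simp add: position_transpose transpose_def)
  then show ?thesis
    using less unfolding column_weight_def split by (simp add: position_transpose)
qed

text \<open>A swap strictly lowers the weight, so starting from weight at most that of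
  \<open>\<tau>\<close> it cannot end in \<open>\<tau>\<close>. The only contribution to this
  coordinate is \<open>\<tau>\<close> fixed by a non-descent.\<close>

lemma lookup_pi_tab_max:
  assumes "column_weight m b \<le> column_weight m \<tau>"
  shows "Poly_Mapping.lookup (pi_tab m i b) \<tau> = of_bool (b = \<tau> \<and> i \<notin> Des m \<tau>)"
proof -
  have "transpose i (i + 1) \<circ> b \<noteq> \<tau>" if "i \<in> Des m b" "\<not> attacking b i"
    using column_weight_swap[OF that] assms by auto
  then show ?thesis
    by (auto simp: pi_tab_def lookup_single when_def)
qed

lemma lookup_pi_op_max:
  assumes "Poly_Mapping.keys x \<subseteq> T" "\<And>b. b \<in> T \<Longrightarrow> column_weight m b \<le> column_weight m \<tau>"
  shows "Poly_Mapping.lookup (pi_op m i x) \<tau> = (if i \<in> Des m \<tau> then 0 else Poly_Mapping.lookup x \<tau>)"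
proof -
  have "Poly_Mapping.lookup (pi_op m i x) \<tau> =
      (\<Sum>b\<in>Poly_Mapping.keys x. if b = \<tau> then (if i \<in> Des m \<tau> then 0 else Poly_Mapping.lookup x \<tau>) else 0)"
    unfolding pi_op_def linear_extension_def Poly_Mapping.lookup_sum
    using assms by (intro sum.cong refl) (auto simp: lookup_pi_tab_max subset_iff)
  then show ?thesis
    by (auto simp: in_keys_iff)
qed

lemma basis_vec_neq_0: "basis_vec b \<noteq> 0"
  by (metis lookup_single_eq lookup_zero one_neq_zero)

text \<open>The quotient map reads off the coordinate at \<open>\<tau>\<close>. It is equivariant by
  \<open>lookup_pi_op_max\<close>, and its kernel consists of the vectors supported away from
  \<open>\<tau>\<close>.\<close>

lemma short_exact_span_module:
  assumes \<tau>: "\<tau> \<in> T" and max: "\<And>b. b \<in> T \<Longrightarrow> column_weight m b \<le> column_weight m \<tau>"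
  shows "short_exact m (span_module m (T - {\<tau>})) (span_module m T)
           (simple_hmodule (comp_tab m \<tau>) (basis_vec \<tau>))"
proof -
  let ?g = "\<lambda>x. cscale (Poly_Mapping.lookup x \<tau>) (basis_vec \<tau>)"
  have Des: "set_of_comp (comp_tab m \<tau>) = Des m \<tau>"
    unfolding comp_tab_def by (rule set_of_comp_of_set) (auto simp: Des_def)
  have lin: "?g (x + y) = ?g x + ?g y" "?g (cscale c x) = cscale c (?g x)" for x y c
    by (simp_all add: lookup_add cspace.scale_left_distrib)
  have "hmodule_hom m (span_module m (T - {\<tau>})) (span_module m T) id"
    by (auto simp: hmodule_hom_def linear_between_def span_module_def span_basis_vec)
  moreover have "hmodule_hom m (span_module m T) (simple_hmodule (comp_tab m \<tau>) (basis_vec \<tau>)) ?g"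
    unfolding hmodule_hom_def linear_between_def
    by (auto simp: span_module_def span_basis_vec simple_hmodule_def cspace.span_singleton lin Des
        lookup_pi_op_max[OF _ max])
  moreover have "?g ` hspace (span_module m T) = hspace (simple_hmodule (comp_tab m \<tau>) (basis_vec \<tau>))"
  proof -
    have "cscale c (basis_vec \<tau>) \<in> ?g ` cspace.span (basis_vec ` T)" for c
      using \<tau> by (intro image_eqI[of _ _ "cscale c (basis_vec \<tau>)"] cspace.span_scale cspace.span_base) auto
    then show ?thesis
      by (auto simp: span_module_def simple_hmodule_def cspace.span_singleton)
  qed
  moreover have "id ` hspace (span_module m (T - {\<tau>})) = {x \<in> hspace (span_module m T). ?g x = 0}"
    using basis_vec_neq_0[of \<tau>] by (auto simp: span_module_def span_basis_vec in_keys_iff)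
  ultimately show ?thesis
    unfolding short_exact_def by (meson inj_on_id)
qed

lemma is_ch_span_module:
  assumes h: "is_ch m h" and "finite T" "pi_closed m T"
  shows "h (groth_class m (span_module m T)) \<mu> = (\<Sum>\<tau>\<in>T. fundamental (comp_tab m \<tau>) \<mu>)"
  using assms(2,3)
proof (induction T rule: finite_psubset_induct)
  case (psubset T)
  show ?case
  proof (cases "T = {}")
    case True
    \<comment> \<open>The zero module is an extension of itself by itself, so its value equals twice
      itself and vanishes.\<close>
    have "short_exact m (span_module m {}) (span_module m {}) (span_module m {})"
      unfolding short_exact_def hmodule_hom_def linear_between_def span_module_def
      by (rule exI[of _ id], rule exI[of _ id]) auto
    moreover have "span_module m {} \<in> fd_hmodules m"
      by (rule span_module_in_fd_hmodules) (auto simp: pi_closed_def)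
    ultimately have "h (groth_class m (span_module m {})) \<mu> =
        h (groth_class m (span_module m {})) \<mu> + h (groth_class m (span_module m {})) \<mu>"
      by (intro is_ch_exact[OF h])
    then show ?thesis unfolding True by simp
  next
    case False
    have "Max (column_weight m ` T) \<in> column_weight m ` T"
      using False psubset.hyps by (intro Max_in) auto
    then obtain \<tau> where \<tau>: "\<tau> \<in> T" and "column_weight m \<tau> = Max (column_weight m ` T)"
      by auto
    then have max: "column_weight m b \<le> column_weight m \<tau>" if "b \<in> T" for b
      using that psubset.hyps by simp
    let ?S = "simple_hmodule (comp_tab m \<tau>) (basis_vec \<tau>)"
    \<comment> \<open>A swap ending in the removed \<open>\<tau>\<close> would have started from a
      larger weight, against maximality.\<close>
    have closed: "pi_closed m (T - {\<tau>})"
      unfolding pi_closed_def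
    proof (intro ballI)
      fix \<rho> i assume *: "\<rho> \<in> T - {\<tau>}" "i \<in> Des m \<rho>"
      then show "attacking \<rho> i \<or> transpose i (i + 1) \<circ> \<rho> \<in> T - {\<tau>}"
        using psubset.prems column_weight_swap[OF *(2)] max[of \<rho>] by (fastforce simp: pi_closed_def)
    qed
    have "comp_tab m \<tau> \<in> compositions m"
      unfolding comp_tab_def by (rule comp_of_set_in_compositions) (auto simp: Des_def)
    then have "h (groth_class m ?S) = fundamental (comp_tab m \<tau>)"
      using h basis_vec_neq_0[of \<tau>] unfolding is_ch_def by blast
    then have "h (groth_class m (span_module m T)) \<mu> =
        h (groth_class m (span_module m (T - {\<tau>}))) \<mu> + fundamental (comp_tab m \<tau>) \<mu>"
      using is_ch_exact[OF h _ _ simple_hmodule_in_fd_hmodules short_exact_span_module[OF \<tau> max]]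
        span_module_in_fd_hmodules closed psubset by simp
    also have "\<dots> = (\<Sum>\<tau>\<in>T. fundamental (comp_tab m \<tau>) \<mu>)"
      using psubset.IH[of "T - {\<tau>}"] closed \<tau> psubset.hyps by (auto simp: sum.remove)
    finally show ?thesis .
  qed
qed

theorem theorem9p8:
  fixes \<alpha> \<beta> :: "nat list" and m :: nat
    and r :: "(filling \<times> filling) set" and \<tau>\<^sub>1 :: filling
  assumes "is_composition \<alpha>" and "is_composition \<beta>"
    and "rc_less \<beta> \<alpha>" and "skew_size \<alpha> \<beta> = m"
    and "linear_order_on (SRCT \<alpha> \<beta>) r" and "srct_le \<alpha> \<beta> \<subseteq> r"
    and "\<tau>\<^sub>1 \<in> SRCT \<alpha> \<beta>" and "\<forall>\<tau>\<in>SRCT \<alpha> \<beta>. (\<tau>, \<tau>\<^sub>1) \<in> r \<longrightarrow> \<tau> = \<tau>\<^sub>1"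
  shows "tableau_module m \<alpha> \<beta> r \<tau>\<^sub>1 \<in> fd_hmodules m \<and>
    qs_characteristic m (tableau_module m \<alpha> \<beta> r \<tau>\<^sub>1) = skew_qschur \<alpha> \<beta>"
proof -
  \<comment> \<open>By totality, the minimal element lies below every tableau, so the spanning set
    is all of \<open>SRCT \<alpha> \<beta>\<close>.\<close>
  have "(\<tau>\<^sub>1, \<tau>) \<in> r" if "\<tau> \<in> SRCT \<alpha> \<beta>" for \<tau>
  proof (cases "\<tau> = \<tau>\<^sub>1")
    case True
    then show ?thesis
      using assms(5,7) by (simp add: order_on_defs refl_on_def)
  next
    case False
    then show ?thesis
      using assms(5,7,8) that by (auto simp: order_on_defs total_on_def)
  qed
  then have "{basis_vec \<tau> | \<tau>. \<tau> \<in> SRCT \<alpha> \<beta> \<and> (\<tau>\<^sub>1, \<tau>) \<in> r} = basis_vec ` SRCT \<alpha> \<beta>"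
    by blast
  then have mod: "tableau_module m \<alpha> \<beta> r \<tau>\<^sub>1 = span_module m (SRCT \<alpha> \<beta>)"
    by (simp add: tableau_module_def span_module_def)
  have closed: "pi_closed m (SRCT \<alpha> \<beta>)"
    using pi_closed_SRCT assms(4) by blast
  have "is_ch m (ch m :: (filling hmodule \<Rightarrow>\<^sub>0 int) set \<Rightarrow> pseries)"
    unfolding ch_def using ex_is_ch by (rule someI_ex)
  then have "qs_characteristic m (span_module m (SRCT \<alpha> \<beta>)) = skew_qschur \<alpha> \<beta>"
    using is_ch_span_module finite_SRCT closed assms(4)
    by (auto simp: qs_characteristic_def skew_qschur_def)
  then show ?thesis
    using mod span_module_in_fd_hmodules[OF closed finite_SRCT] by simp
qed

end
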